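(* Let $m\ge2$ and $d$ be positive integers, $0\le\mu<1$ and $\zeta>0$. Let $f=\sum_{k=1}^m\pi_k\prod_{j=1}^d f_{kj}$ be a $(\mu,\zeta)$-estimable function supported on $[0,1]^d$, and let $\tilde f=\sum_{k=1}^m\tilde\pi_k\prod_{j=1}^d\tilde f_{kj}$ be a proper estimator of $f$. Assume that there exists a universal constant $C\ge 1$ such that $\|f_{kj}\|_\infty\le C$ and $\|\tilde f_{kj}\|_\infty\le C$ for all $k\in[m]$, $j\in[d]$. Let $L_m=4m^{3/2}(m-1)!>0$. If $\|f-\tilde f\|_2\le\epsilon$ for some $$\epsilon<\frac{(1-\mu)^{2m-1}\zeta^2}{32\,m^{5/2}L_m^2C^{2m}},$$ then there exists a permutation $\sigma:[m]\to[m]$ such that, for all $k\in[m]$ and $j\in[d]$, $$\|f_{kj}-\tilde f_{\sigma(k)j}\|_2\le\frac{8C^2L_m}{(1-\mu)^{m-1}\zeta}\,\epsilon,$$ and $$\|\pi-\sigma(\tilde\pi)\|_2:=\sqrt{\sum_{k=1}^m(\pi_k-\tilde\pi_{\sigma(k)})^2}\le\frac{16\,C^{2m-2}L_m^2}{(1-\mu)^{\frac{3(m-1)}{2}}\zeta}\,\epsilon.$$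
   Context: Notation: $[n]=\{1,\dots,n\}$. The expression $f=\sum_{k=1}^m\pi_k\prod_{j=1}^d f_{kj}$ means $f(x_1,\dots,x_d)=\sum_{k=1}^m\pi_k\prod_{j=1}^d f_{kj}(x_j)$, where $\pi_k>0$, $\sum_{k=1}^m\pi_k=1$, and each $f_{kj}$ is a probability density (with respect to Lebesgue measure) on $\mathbb{R}$. Norms $\|\cdot\|_2$ of functions are $L^2$ norms with respect to Lebesgue measure. An estimator $\tilde f$ is proper if it is itself of this form, $\tilde f=\sum_{k=1}^m\tilde\pi_k\prod_{j=1}^d\tilde f_{kj}$, with mixing weights $\tilde\pi_k$ and probability densities $\tilde f_{kj}$. $\mu$-incoherence: for $0\le\mu<1$, elements $g_1,\dots,g_m$ of a Hilbert space are $\mu$-incoherent if $|\langle g_k,g_{k'}\rangle|\le\mu\|g_k\|_2\|g_{k'}\|_2$ for all $k\ne k'$. $(\mu,\zeta)$-estimable: $f=\sum_{k=1}^m\pi_k\prod_{j=1}^d f_{kj}$ is $(\mu,\zeta)$-estimable if (1) all $f_{kj}$ are square integrable and, for each $j\in[d]$, the family $\{f_{kj}\}_{k=1}^m$ is $\mu$-incoherent (in $L^2$) with $\mu<1$; and (2) $\min_{k\in[m]}\pi_k\ge\zeta>0$.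
   Formalization: The formal theorem additionally assumes d ≥ 2m−1; for every m ≥ 2 and 1 ≤ d ≤ 2m−2 the claim as stated fails for suitable μ, ζ, C, since two mixtures with different components can give the same f (ε = 0). *)

theory Defs
  imports "HOL-Probability.Probability"
begin

section \<open>Norms of functions\<close>

text \<open>
  The Bochner integral of a non-integrable function is \<open>0\<close>, so \<open>l2_norm M f\<close> is the
  \<open>L\<^sup>2\<close> norm only for square integrable \<open>f\<close>. Essentially bounded densities are square
  integrable, and so are the finite mixtures of products of such densities.
\<close>

definition square_integrable :: "'a measure \<Rightarrow> ('a \<Rightarrow> real) \<Rightarrow> bool" where
  "square_integrable M f \<longleftrightarrow> f \<in> borel_measurable M \<and> integrable M (\<lambda>x. (f x)\<^sup>2)"

definition l2_inner :: "'a measure \<Rightarrow> ('a \<Rightarrow> real) \<Rightarrow> ('a \<Rightarrow> real) \<Rightarrow> real" where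
  "l2_inner M f g = (\<integral>x. f x * g x \<partial>M)"

definition l2_norm :: "'a measure \<Rightarrow> ('a \<Rightarrow> real) \<Rightarrow> real" where
  "l2_norm M f = sqrt (\<integral>x. (f x)\<^sup>2 \<partial>M)"

definition linf_norm :: "'a measure \<Rightarrow> ('a \<Rightarrow> real) \<Rightarrow> ereal" where
  "linf_norm M f = esssup M (\<lambda>x. ereal \<bar>f x\<bar>)"


section \<open>Mixtures of product densities\<close>

text \<open>
  Points of \<open>\<real>\<^sup>d\<close> are the extensional functions on \<open>{1..d}\<close>; \<open>lebesgue_pow d\<close> is
  \<open>d\<close>-dimensional Lebesgue measure on them.
\<close>

definition lebesgue_pow :: "nat \<Rightarrow> (nat \<Rightarrow> real) measure" where
  "lebesgue_pow d = (\<Pi>\<^sub>M j\<in>{1..d}. lborel)"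

definition unit_cube :: "nat \<Rightarrow> (nat \<Rightarrow> real) set" where
  "unit_cube d = (\<Pi>\<^sub>E j\<in>{1..d}. {0..1})"

definition is_density :: "(real \<Rightarrow> real) \<Rightarrow> bool" where
  "is_density g \<longleftrightarrow> (AE x in lborel. 0 \<le> g x) \<and> has_bochner_integral lborel g 1"

definition mixture ::
    "nat \<Rightarrow> nat \<Rightarrow> (nat \<Rightarrow> real) \<Rightarrow> (nat \<Rightarrow> nat \<Rightarrow> real \<Rightarrow> real) \<Rightarrow> (nat \<Rightarrow> real) \<Rightarrow> real" where
  "mixture m d w F x = (\<Sum>k\<in>{1..m}. w k * (\<Prod>j\<in>{1..d}. F k j (x j)))"

text \<open>
  \<open>mixture_params m d w F\<close> states that \<open>w\<close> and \<open>F\<close> are admissible weights and component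
  densities. For an estimate, this is properness.
\<close>

definition mixture_params ::
    "nat \<Rightarrow> nat \<Rightarrow> (nat \<Rightarrow> real) \<Rightarrow> (nat \<Rightarrow> nat \<Rightarrow> real \<Rightarrow> real) \<Rightarrow> bool" where
  "mixture_params m d w F \<longleftrightarrow>
     (\<forall>k\<in>{1..m}. 0 < w k) \<and> (\<Sum>k\<in>{1..m}. w k) = 1 \<and>
     (\<forall>k\<in>{1..m}. \<forall>j\<in>{1..d}. is_density (F k j))"

definition supported_on_unit_cube :: "nat \<Rightarrow> ((nat \<Rightarrow> real) \<Rightarrow> real) \<Rightarrow> bool" where
  "supported_on_unit_cube d f \<longleftrightarrow> (AE x in lebesgue_pow d. x \<notin> unit_cube d \<longrightarrow> f x = 0)"


section \<open>Incoherence and estimability\<close>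

definition incoherent :: "'a measure \<Rightarrow> real \<Rightarrow> 'i set \<Rightarrow> ('i \<Rightarrow> 'a \<Rightarrow> real) \<Rightarrow> bool" where
  "incoherent M \<mu> I g \<longleftrightarrow>
     (\<forall>k\<in>I. \<forall>k'\<in>I. k \<noteq> k' \<longrightarrow>
        \<bar>l2_inner M (g k) (g k')\<bar> \<le> \<mu> * l2_norm M (g k) * l2_norm M (g k'))"

definition estimable ::
    "real \<Rightarrow> real \<Rightarrow> nat \<Rightarrow> nat \<Rightarrow> (nat \<Rightarrow> real) \<Rightarrow> (nat \<Rightarrow> nat \<Rightarrow> real \<Rightarrow> real) \<Rightarrow> bool" where
  "estimable \<mu> \<zeta> m d w F \<longleftrightarrow>
     mixture_params m d w F \<and>
     (\<forall>k\<in>{1..m}. \<forall>j\<in>{1..d}. square_integrable lborel (F k j)) \<and>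
     0 \<le> \<mu> \<and> \<mu> < 1 \<and> (\<forall>j\<in>{1..d}. incoherent lborel \<mu> {1..m} (\<lambda>k. F k j)) \<and>
     0 < \<zeta> \<and> \<zeta> \<le> Min (w ` {1..m})"

definition L_const :: "nat \<Rightarrow> real" where
  "L_const m = 4 * real m powr (3/2) * fact (m - 1)"

end

theory Submission
  imports Defs "Jordan_Normal_Form.Determinant"
begin

text \<open>
  Split off two disjoint blocks \<open>S\<close>, \<open>T\<close> of \<open>m - 1\<close> coordinates and one further coordinate \<open>i\<close>. On a block of
  \<open>m - 1\<close> coordinates the products \<open>\<Prod>\<^sub>j f\<^sub>k\<^sub>j\<close> have a dual family of product functions: against component \<open>k\<close>,
  use each coordinate of the block to kill one of the \<open>m - 1\<close> other components. Testing \<open>f\<close> and its estimate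
  against duals on \<open>S\<close> and \<open>T\<close>, and against the indicator of the unit interval on the remaining coordinates,
  gives \<open>\<delta>\<^sub>k\<^sub>k\<^sub>' \<pi>\<^sub>k f\<^sub>k\<^sub>i \<approx> \<Sum>\<^sub>l v\<^sub>l P\<^sub>k\<^sub>l Q\<^sub>k\<^sub>'\<^sub>l g\<^sub>l\<^sub>i\<close>, an approximate simultaneous diagonalisation. Inverting \<open>Q\<close> and
  arguing as for Gershgorin discs, every \<open>g\<^sub>l\<^sub>i\<close>, normalised to mass 1 on the unit interval, is close to one
  \<open>f\<^sub>k\<^sub>i\<close>, where \<open>k\<close> depends on \<open>l\<close> and \<open>T\<close> only; the matching is onto because \<open>Q\<close> has bounded entries, and two
  disjoint blocks \<open>T\<close> give the same matching by incoherence. Finally, the mass of the estimate outside the unit cube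
  is at most \<open>\<epsilon>\<close>, which controls the normalisation and the weights.
\<close>

section \<open>The space of square integrable functions\<close>

lemma square_integrable_mult:
  assumes "square_integrable M f" "square_integrable M g"
  shows "integrable M (\<lambda>x. f x * g x)"
proof (rule Bochner_Integration.integrable_bound)
  show "integrable M (\<lambda>x. (f x)\<^sup>2 + (g x)\<^sup>2)" "(\<lambda>x. f x * g x) \<in> borel_measurable M"
    using assms by (auto simp: square_integrable_def)
  have "\<bar>a * b\<bar> \<le> a\<^sup>2 + b\<^sup>2" for a b :: real
    using sum_squares_bound[of "\<bar>a\<bar>" "\<bar>b\<bar>"] zero_le_power2[of a] zero_le_power2[of b]
    unfolding abs_mult power2_abs by linarith
  then show "AE x in M. norm (f x * g x) \<le> norm ((f x)\<^sup>2 + (g x)\<^sup>2)" by simp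
qed

lemma square_integrable_scale:
  "square_integrable M f \<Longrightarrow> square_integrable M (\<lambda>x. c * f x)"
  by (auto simp: square_integrable_def power_mult_distrib)

lemma square_integrable_add:
  assumes "square_integrable M f" "square_integrable M g"
  shows "square_integrable M (\<lambda>x. f x + g x)"
proof -
  have "integrable M (\<lambda>x. (f x)\<^sup>2 + (g x)\<^sup>2 + 2 * (f x * g x))"
    using assms square_integrable_mult[OF assms] by (auto simp: square_integrable_def)
  moreover have "(\<lambda>x. f x + g x) \<in> borel_measurable M"
    using assms by (intro borel_measurable_add) (auto simp: square_integrable_def)
  ultimately show ?thesis
    by (simp add: square_integrable_def power2_sum algebra_simps)
qed

lemma square_integrable_diff:
  assumes "square_integrable M f" "square_integrable M g"
  shows "square_integrable M (\<lambda>x. f x - g x)"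
  using square_integrable_add[OF assms(1) square_integrable_scale[OF assms(2), of "-1"]] by simp

lemma square_integrable_minus: "square_integrable M f \<Longrightarrow> square_integrable M (\<lambda>x. - f x)"
  using square_integrable_scale[of M f "-1"] by simp

lemma square_integrable_zero: "square_integrable M (\<lambda>_. 0)"
  by (simp add: square_integrable_def)

lemma square_integrable_sum:
  assumes "\<And>i. i \<in> I \<Longrightarrow> square_integrable M (f i)"
  shows "square_integrable M (\<lambda>x. \<Sum>i\<in>I. f i x)"
  using assms
proof (induction I rule: infinite_finite_induct)
  case (insert i I)
  then show ?case by (simp add: square_integrable_add)
qed (simp_all add: square_integrable_def)

lemma square_integrable_cmult_sum:
  assumes "\<And>i. i \<in> I \<Longrightarrow> square_integrable M (f i)"
  shows "square_integrable M (\<lambda>x. \<Sum>i\<in>I. c i * f i x)"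
  by (intro square_integrable_sum square_integrable_scale assms)

lemma l2_norm_nonneg: "0 \<le> l2_norm M f"
  by (simp add: l2_norm_def)

lemma l2_norm_eq: "l2_norm M f = sqrt (l2_inner M f f)"
  by (simp add: l2_norm_def l2_inner_def power2_eq_square)

\<comment> \<open>The stability argument runs in an arbitrary \<open>real_inner\<close> space, whose
  inner product must be definite. Square integrable functions are therefore identified when they
  agree almost everywhere; the relation is partial so that its domain also encodes square
  integrability.\<close>
quotient_type l2 = "real \<Rightarrow> real" / partial:
  "\<lambda>f g. square_integrable lborel f \<and> square_integrable lborel g \<and> (AE x in lborel. f x = g x)"
proof (rule part_equivpI)
  show "\<exists>f. square_integrable lborel f \<and> square_integrable lborel f \<and> (AE x in lborel. f x = f x)"
    by (rule exI[of _ "\<lambda>_. 0"]) (simp add: square_integrable_def)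
  show "transp (\<lambda>f g. square_integrable lborel f \<and> square_integrable lborel g \<and> (AE x in lborel. f x = g x))"
    by (rule transpI) (auto elim: eventually_elim2)
qed (auto intro!: sympI simp: eq_commute)

instantiation l2 :: real_vector
begin

lift_definition zero_l2 :: l2 is "\<lambda>_. 0"
  by (simp add: square_integrable_zero)

lift_definition plus_l2 :: "l2 \<Rightarrow> l2 \<Rightarrow> l2" is "\<lambda>f g x. f x + g x"
  by (auto intro: square_integrable_add)

lift_definition uminus_l2 :: "l2 \<Rightarrow> l2" is "\<lambda>f x. - f x"
  by (auto intro: square_integrable_minus)

lift_definition minus_l2 :: "l2 \<Rightarrow> l2 \<Rightarrow> l2" is "\<lambda>f g x. f x - g x"
  by (auto intro: square_integrable_diff)

lift_definition scaleR_l2 :: "real \<Rightarrow> l2 \<Rightarrow> l2" is "\<lambda>c f x. c * f x"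
  by (auto intro: square_integrable_scale)

instance
proof
  note closed = square_integrable_add square_integrable_diff square_integrable_scale square_integrable_minus
  fix x y z :: l2 and a b :: real
  show "x + y + z = x + (y + z)" by transfer (simp add: closed add.assoc)
  show "x + y = y + x" by transfer (simp add: closed add.commute)
  show "0 + x = x" by transfer simp
  show "- x + x = 0" by transfer (simp add: closed square_integrable_zero)
  show "x - y = x + - y" by transfer (simp add: closed)
  show "a *\<^sub>R (x + y) = a *\<^sub>R x + a *\<^sub>R y" by transfer (simp add: closed distrib_left)
  show "(a + b) *\<^sub>R x = a *\<^sub>R x + b *\<^sub>R x" by transfer (simp add: closed distrib_right)
  show "a *\<^sub>R b *\<^sub>R x = (a * b) *\<^sub>R x" by transfer (simp add: closed mult.assoc)
  show "1 *\<^sub>R x = x" by transfer simp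
qed

end

instantiation l2 :: real_inner
begin

lift_definition inner_l2 :: "l2 \<Rightarrow> l2 \<Rightarrow> real" is "l2_inner lborel"
  unfolding l2_inner_def square_integrable_def by (intro integral_cong_AE) auto

definition "norm_l2 (x :: l2) = sqrt (inner x x)"
definition "dist_l2 (x :: l2) y = norm (x - y)"
definition "sgn_l2 (x :: l2) = x /\<^sub>R norm x"
definition "uniformity_l2 = (INF e\<in>{0 <..}. principal {(x :: l2, y). dist x y < e})"
definition "open_l2 (U :: l2 set) = (\<forall>x\<in>U. eventually (\<lambda>(x', y). x' = x \<longrightarrow> y \<in> U) uniformity)"

instance
proof
  fix x y z :: l2 and r :: real
  show "inner x y = inner y x"
    by transfer (simp add: l2_inner_def mult.commute)
  show "inner (x + y) z = inner x z + inner y z"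
    by transfer (auto simp: l2_inner_def distrib_right intro!: Bochner_Integration.integral_add square_integrable_mult)
  show "inner (r *\<^sub>R x) y = r * inner x y"
    by transfer (simp add: l2_inner_def mult.assoc)
  show "0 \<le> inner x x"
    by transfer (simp add: l2_inner_def)
  show "(inner x x = 0) = (x = 0)"
  proof transfer
    fix f :: "real \<Rightarrow> real"
    assume "square_integrable lborel f \<and> square_integrable lborel f \<and> (AE x in lborel. f x = f x)"
    then have "integrable lborel (\<lambda>x. f x * f x)" "square_integrable lborel f"
      by (auto intro: square_integrable_mult)
    then show "(l2_inner lborel f f = 0) = (square_integrable lborel f \<and> square_integrable lborel (\<lambda>_. 0) \<and>
        (AE x in lborel. f x = 0))"
      by (simp add: l2_inner_def integral_nonneg_eq_0_iff_AE square_integrable_def)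
  qed
qed (simp_all only: dist_l2_def norm_l2_def sgn_l2_def uniformity_l2_def open_l2_def)

end

lemma inner_abs_l2:
  "square_integrable lborel f \<Longrightarrow> square_integrable lborel g \<Longrightarrow> inner (abs_l2 f) (abs_l2 g) = l2_inner lborel f g"
  by (simp add: inner_l2.abs_eq)

lemma norm_abs_l2: "square_integrable lborel f \<Longrightarrow> norm (abs_l2 f) = l2_norm lborel f"
  by (simp add: norm_l2_def inner_abs_l2 l2_norm_eq)

lemma abs_l2_diff:
  "square_integrable lborel f \<Longrightarrow> square_integrable lborel g \<Longrightarrow> abs_l2 f - abs_l2 g = abs_l2 (\<lambda>x. f x - g x)"
  by (simp add: minus_l2.abs_eq)

lemma l2_cases:
  obtains f where "square_integrable lborel f" "x = abs_l2 f"
  using Quotient3_abs_rep[OF Quotient3_l2, of x] Quotient3_rel_rep[OF Quotient3_l2, of x x] by metis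

text \<open>Stated for every measure, since it is needed on \<open>lebesgue_pow d\<close>, which the
  type \<open>l2\<close> does not cover. The squared norm of \<open>f - t * g\<close> is a
  nonnegative quadratic polynomial in \<open>t\<close>; its value at the minimum gives the
  inequality.\<close>

lemma l2_Cauchy_Schwarz:
  assumes f: "square_integrable M f" and g: "square_integrable M g"
  shows "\<bar>l2_inner M f g\<bar> \<le> l2_norm M f * l2_norm M g"
proof -
  have q: "0 \<le> l2_inner M f f + t\<^sup>2 * l2_inner M g g - 2 * t * l2_inner M f g" for t
  proof -
    have "0 \<le> (\<integral>x. (f x - t * g x)\<^sup>2 \<partial>M)" by simp
    also have "\<dots> = (\<integral>x. f x * f x + t\<^sup>2 * (g x * g x) - 2 * t * (f x * g x) \<partial>M)"
      by (rule Bochner_Integration.integral_cong) (auto simp: power2_eq_square algebra_simps)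
    also have "\<dots> = l2_inner M f f + t\<^sup>2 * l2_inner M g g - 2 * t * l2_inner M f g"
      using square_integrable_mult[OF f f] square_integrable_mult[OF g g] square_integrable_mult[OF f g]
      by (simp add: l2_inner_def)
    finally show ?thesis .
  qed
  have "(l2_inner M f g)\<^sup>2 \<le> l2_inner M f f * l2_inner M g g"
  proof (cases "l2_inner M g g = 0")
    case True
    have "l2_inner M f g = 0"
    proof (rule ccontr)
      \<comment> \<open>The polynomial is now affine in \<open>t\<close>, and the chosen
        \<open>t\<close> gives it the value \<open>- 1\<close>.\<close>
      assume "l2_inner M f g \<noteq> 0"
      then show False
        using q[of "(l2_inner M f f + 1) / (2 * l2_inner M f g)"] True by (simp add: field_simps)
    qed
    then show ?thesis using True by simp
  next
    case False
    have "0 \<le> l2_inner M g g" by (simp add: l2_inner_def)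
    with False show ?thesis
      using q[of "l2_inner M f g / l2_inner M g g"] by (simp add: field_simps power2_eq_square)
  qed
  then have "sqrt ((l2_inner M f g)\<^sup>2) \<le> sqrt (l2_inner M f f * l2_inner M g g)"
    by (rule real_sqrt_le_mono)
  then show ?thesis by (simp only: l2_norm_eq real_sqrt_mult real_sqrt_abs)
qed

section \<open>Product functions and mixtures on \<open>d\<close>-dimensional space\<close>

interpretation lborel_power: product_sigma_finite "\<lambda>_ :: nat. lborel :: real measure" ..

lemma square_integrable_prod:
  assumes h: "\<And>j. j \<in> {1..d} \<Longrightarrow> square_integrable lborel (h j)"
  shows "square_integrable (lebesgue_pow d) (\<lambda>x. \<Prod>j\<in>{1..d}. h j (x j))"
proof -
  have "integrable (lebesgue_pow d) (\<lambda>x. \<Prod>j\<in>{1..d}. (h j (x j))\<^sup>2)"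
    unfolding lebesgue_pow_def
    by (rule lborel_power.product_integrable_prod) (use h in \<open>auto simp: square_integrable_def\<close>)
  moreover have "(\<lambda>x. \<Prod>j\<in>{1..d}. h j (x j)) \<in> borel_measurable (lebesgue_pow d)"
    unfolding lebesgue_pow_def
  proof (rule borel_measurable_prod)
    fix j assume "j \<in> {1..d}"
    moreover from this have [measurable]: "h j \<in> borel_measurable lborel"
      using h by (auto simp: square_integrable_def)
    ultimately show "(\<lambda>x. h j (x j)) \<in> borel_measurable (\<Pi>\<^sub>M j\<in>{1..d}. lborel)"
      by measurable
  qed
  ultimately show ?thesis by (simp add: square_integrable_def prod_power_distrib)
qed

lemma l2_inner_prod:
  assumes f: "\<And>j. j \<in> {1..d} \<Longrightarrow> square_integrable lborel (f j)"
    and h: "\<And>j. j \<in> {1..d} \<Longrightarrow> square_integrable lborel (h j)"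
  shows "l2_inner (lebesgue_pow d) (\<lambda>x. \<Prod>j\<in>{1..d}. f j (x j)) (\<lambda>x. \<Prod>j\<in>{1..d}. h j (x j))
    = (\<Prod>j\<in>{1..d}. l2_inner lborel (f j) (h j))"
  unfolding l2_inner_def lebesgue_pow_def prod.distrib[symmetric]
  by (rule lborel_power.product_integral_prod) (auto intro!: square_integrable_mult f h)

lemma l2_norm_prod:
  assumes h: "\<And>j. j \<in> {1..d} \<Longrightarrow> square_integrable lborel (h j)"
  shows "l2_norm (lebesgue_pow d) (\<lambda>x. \<Prod>j\<in>{1..d}. h j (x j)) = (\<Prod>j\<in>{1..d}. l2_norm lborel (h j))"
proof -
  have "sqrt (\<Prod>j\<in>{1..d}. l2_inner lborel (h j) (h j)) = (\<Prod>j\<in>{1..d}. sqrt (l2_inner lborel (h j) (h j)))"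
    by (induction d) (simp_all add: real_sqrt_mult)
  then show ?thesis by (simp only: l2_norm_eq l2_inner_prod[OF h h])
qed

lemma l2_inner_cmult_sum:
  assumes "\<And>k. k \<in> K \<Longrightarrow> square_integrable M (f k)" "square_integrable M h"
  shows "l2_inner M (\<lambda>x. \<Sum>k\<in>K. c k * f k x) h = (\<Sum>k\<in>K. c k * l2_inner M (f k) h)"
proof -
  have "l2_inner M (\<lambda>x. \<Sum>k\<in>K. c k * f k x) h = (\<integral>x. (\<Sum>k\<in>K. c k * (f k x * h x)) \<partial>M)"
    by (simp add: l2_inner_def sum_distrib_right mult.assoc)
  also have "\<dots> = (\<Sum>k\<in>K. \<integral>x. c k * (f k x * h x) \<partial>M)"
    by (rule Bochner_Integration.integral_sum) (auto intro!: square_integrable_mult assms)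
  finally show ?thesis by (simp add: l2_inner_def)
qed

lemma l2_inner_mixture:
  assumes F: "\<And>k j. k \<in> {1..m} \<Longrightarrow> j \<in> {1..d} \<Longrightarrow> square_integrable lborel (F k j)"
    and h: "\<And>j. j \<in> {1..d} \<Longrightarrow> square_integrable lborel (h j)"
  shows "l2_inner (lebesgue_pow d) (mixture m d w F) (\<lambda>x. \<Prod>j\<in>{1..d}. h j (x j))
    = (\<Sum>k\<in>{1..m}. w k * (\<Prod>j\<in>{1..d}. l2_inner lborel (F k j) (h j)))"
proof -
  have "l2_inner (lebesgue_pow d) (mixture m d w F) (\<lambda>x. \<Prod>j\<in>{1..d}. h j (x j))
      = (\<Sum>k\<in>{1..m}. w k * l2_inner (lebesgue_pow d) (\<lambda>x. \<Prod>j\<in>{1..d}. F k j (x j)) (\<lambda>x. \<Prod>j\<in>{1..d}. h j (x j)))"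
    unfolding mixture_def[abs_def] by (intro l2_inner_cmult_sum square_integrable_prod F h)
  also have "\<dots> = (\<Sum>k\<in>{1..m}. w k * (\<Prod>j\<in>{1..d}. l2_inner lborel (F k j) (h j)))"
    by (intro sum.cong refl arg_cong[where f = "\<lambda>y. _ * y"] l2_inner_prod F h)
  finally show ?thesis .
qed

text \<open>Against a product test function every inner product factors over the coordinates by
  Fubini. The left-hand side is thus the inner product of the difference of the mixtures with that
  test function, and Cauchy-Schwarz applies. In \<open>l2\<close> this becomes the assumption
  \<open>close\<close> of the locale below.\<close>

lemma mixture_inner_le:
  fixes F F' :: "nat \<Rightarrow> nat \<Rightarrow> real \<Rightarrow> real"
  assumes F: "\<And>k j. k \<in> {1..m} \<Longrightarrow> j \<in> {1..d} \<Longrightarrow> square_integrable lborel (F k j)"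
    and F': "\<And>k j. k \<in> {1..m} \<Longrightarrow> j \<in> {1..d} \<Longrightarrow> square_integrable lborel (F' k j)"
    and h: "\<And>j. j \<in> {1..d} \<Longrightarrow> square_integrable lborel (h j)"
  shows "\<bar>(\<Sum>k\<in>{1..m}. w k * (\<Prod>j\<in>{1..d}. l2_inner lborel (F k j) (h j)))
      - (\<Sum>k\<in>{1..m}. w' k * (\<Prod>j\<in>{1..d}. l2_inner lborel (F' k j) (h j)))\<bar>
    \<le> l2_norm (lebesgue_pow d) (\<lambda>x. mixture m d w F x - mixture m d w' F' x)
        * (\<Prod>j\<in>{1..d}. l2_norm lborel (h j))"
proof -
  let ?h = "\<lambda>x. \<Prod>j\<in>{1..d}. h j (x j)" and ?M = "lebesgue_pow d"
  have sq: "square_integrable ?M (mixture m d w F)" "square_integrable ?M (mixture m d w' F')"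
    unfolding mixture_def[abs_def] by (intro square_integrable_cmult_sum square_integrable_prod F F'; assumption)+
  have sqh: "square_integrable ?M ?h" by (rule square_integrable_prod[OF h])
  have "l2_inner ?M (\<lambda>x. mixture m d w F x - mixture m d w' F' x) ?h
      = l2_inner ?M (mixture m d w F) ?h - l2_inner ?M (mixture m d w' F') ?h"
    using square_integrable_mult[OF sq(1) sqh] square_integrable_mult[OF sq(2) sqh]
    by (simp add: l2_inner_def left_diff_distrib)
  also have "l2_inner ?M (mixture m d w F) ?h = (\<Sum>k\<in>{1..m}. w k * (\<Prod>j\<in>{1..d}. l2_inner lborel (F k j) (h j)))"
    by (rule l2_inner_mixture[OF F h])
  also have "l2_inner ?M (mixture m d w' F') ?h = (\<Sum>k\<in>{1..m}. w' k * (\<Prod>j\<in>{1..d}. l2_inner lborel (F' k j) (h j)))"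
    by (rule l2_inner_mixture[OF F' h])
  finally show ?thesis
    using l2_Cauchy_Schwarz[OF square_integrable_diff[OF sq] sqh] by (simp only: l2_norm_prod[OF h])
qed

text \<open>Almost everywhere \<open>(g x)\<^sup>2 \<le> C * g x\<close>, and \<open>g\<close> has
  integral 1. Hence \<open>sqrt C\<close> bounds the norms of all component densities.\<close>

lemma bounded_density_square_integrable:
  assumes g: "is_density g" and C: "linf_norm lborel g \<le> ereal C"
  shows "square_integrable lborel g" "(l2_norm lborel g)\<^sup>2 \<le> C"
proof -
  have int: "integrable lborel g" "(\<integral>x. g x \<partial>lborel) = 1" and pos: "AE x in lborel. 0 \<le> g x"
    using g by (auto simp: is_density_def has_bochner_integral_iff)
  then have [measurable]: "g \<in> borel_measurable lborel" by auto
  have "AE x in lborel. ereal \<bar>g x\<bar> \<le> linf_norm lborel g"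
    unfolding linf_norm_def by (rule esssup_AE)
  then have bd: "AE x in lborel. (g x)\<^sup>2 \<le> C * g x"
    using pos
  proof eventually_elim
    case (elim x)
    then have "ereal \<bar>g x\<bar> \<le> ereal C" using C by (meson order_trans)
    then show ?case using elim by (auto simp: power2_eq_square intro!: mult_right_mono)
  qed
  have sq: "integrable lborel (\<lambda>x. (g x)\<^sup>2)"
  proof (rule Bochner_Integration.integrable_bound)
    show "integrable lborel (\<lambda>x. C * g x)" using int by simp
    show "AE x in lborel. norm ((g x)\<^sup>2) \<le> norm (C * g x)" using bd by eventually_elim auto
  qed auto
  then show "square_integrable lborel g" by (simp add: square_integrable_def)
  have "(\<integral>x. (g x)\<^sup>2 \<partial>lborel) \<le> (\<integral>x. C * g x \<partial>lborel)"
    using sq int bd by (intro integral_mono_AE) auto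
  then show "(l2_norm lborel g)\<^sup>2 \<le> C" by (simp add: l2_norm_def int)
qed

section \<open>Mass on the unit interval and on the unit cube\<close>

lemma indicator_power_eq: "(indicator A x :: real)\<^sup>2 = indicator A x"
  by (simp add: indicator_def)

lemma square_integrable_indicator: "square_integrable lborel (indicator {0..1::real} :: real \<Rightarrow> real)"
  by (simp add: square_integrable_def indicator_power_eq)

lemma l2_norm_indicator: "l2_norm lborel (indicator {0..1::real} :: real \<Rightarrow> real) = 1"
  by (simp add: l2_norm_def indicator_power_eq)

lemma density_mass_bounds:
  assumes g: "is_density g"
  shows "0 \<le> l2_inner lborel g (indicator A)" "l2_inner lborel g (indicator A) \<le> 1" 
proof -
  have int: "integrable lborel g" "(\<integral>x. g x \<partial>lborel) = 1" and pos: "AE x in lborel. 0 \<le> g x"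
    using g by (auto simp: is_density_def has_bochner_integral_iff)
  show "0 \<le> l2_inner lborel g (indicator A)"
    unfolding l2_inner_def by (rule integral_nonneg_AE) (use pos in \<open>eventually_elim, simp\<close>)
  show "l2_inner lborel g (indicator A) \<le> 1"
    unfolding l2_inner_def int(2)[symmetric]
    by (rule integral_mono_AE') (use pos in \<open>auto simp: int indicator_def elim: eventually_mono\<close>)
qed

lemma mixture_mass:
  assumes F: "\<And>k j. k \<in> {1..m} \<Longrightarrow> j \<in> {1..d} \<Longrightarrow> integrable lborel (F k j)"
  shows "integrable (lebesgue_pow d) (mixture m d w F)"
    "(\<integral>x. mixture m d w F x \<partial>lebesgue_pow d) = (\<Sum>k\<in>{1..m}. w k * (\<Prod>j\<in>{1..d}. \<integral>x. F k j x \<partial>lborel))"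
proof -
  have p: "integrable (lebesgue_pow d) (\<lambda>x. \<Prod>j\<in>{1..d}. F k j (x j))" if "k \<in> {1..m}" for k
    unfolding lebesgue_pow_def by (rule lborel_power.product_integrable_prod) (auto intro: F that)
  show "integrable (lebesgue_pow d) (mixture m d w F)"
    unfolding mixture_def[abs_def] by (intro Bochner_Integration.integrable_sum integrable_mult_right p)
  show "(\<integral>x. mixture m d w F x \<partial>lebesgue_pow d) = (\<Sum>k\<in>{1..m}. w k * (\<Prod>j\<in>{1..d}. \<integral>x. F k j x \<partial>lborel))"
  proof -
    have "(\<integral>x. mixture m d w F x \<partial>lebesgue_pow d)
        = (\<Sum>k\<in>{1..m}. \<integral>x. w k * (\<Prod>j\<in>{1..d}. F k j (x j)) \<partial>lebesgue_pow d)"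
      unfolding mixture_def by (intro Bochner_Integration.integral_sum integrable_mult_right p)
    also have "\<dots> = (\<Sum>k\<in>{1..m}. w k * (\<Prod>j\<in>{1..d}. \<integral>x. F k j x \<partial>lborel))"
    proof (intro sum.cong refl)
      fix k assume "k \<in> {1..m}"
      then have "(\<integral>x. (\<Prod>j\<in>{1..d}. F k j (x j)) \<partial>lebesgue_pow d) = (\<Prod>j\<in>{1..d}. \<integral>x. F k j x \<partial>lborel)"
        unfolding lebesgue_pow_def by (intro lborel_power.product_integral_prod F) auto
      then show "(\<integral>x. w k * (\<Prod>j\<in>{1..d}. F k j (x j)) \<partial>lebesgue_pow d)
          = w k * (\<Prod>j\<in>{1..d}. \<integral>x. F k j x \<partial>lborel)" by simp
    qed
    finally show ?thesis .
  qed
qed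

text \<open>Cutting off each factor outside the unit interval changes the mixture only on a null
  set. Its total mass is therefore both the sum of the weights and the sum of the weights times
  products of masses \<open>c k j \<le> 1\<close>. With positive weights, equality forces every
  \<open>c k j\<close> to be 1.\<close>

lemma unit_cube_mass:
  assumes par: "mixture_params m d w F" and supp: "supported_on_unit_cube d (mixture m d w F)"
    and k: "k \<in> {1..m}" and j: "j \<in> {1..d}"
  shows "l2_inner lborel (F k j) (indicator {0..1}) = 1"
proof -
  define c where "c k j = l2_inner lborel (F k j) (indicator {0..1})" for k j
  have dens: "is_density (F k j)" if "k \<in> {1..m}" "j \<in> {1..d}" for k j
    using par that by (auto simp: mixture_params_def)
  have int: "integrable lborel (F k j)" "(\<integral>x. F k j x \<partial>lborel) = 1" if "k \<in> {1..m}" "j \<in> {1..d}" for k j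
    using dens[OF that] by (auto simp: is_density_def has_bochner_integral_iff)
  have c01: "0 \<le> c k j" "c k j \<le> 1" if "k \<in> {1..m}" "j \<in> {1..d}" for k j
    using density_mass_bounds[OF dens[OF that]] by (auto simp: c_def)
  have w: "0 < w k" if "k \<in> {1..m}" for k using par that by (auto simp: mixture_params_def)
  let ?G = "\<lambda>k j x. F k j x * indicator {0..1} x :: real"
  have Gint: "integrable lborel (?G k j)" if "k \<in> {1..m}" "j \<in> {1..d}" for k j
    using int(1)[OF that] by (intro integrable_real_mult_indicator) auto
  have "(\<integral>x. mixture m d w F x \<partial>lebesgue_pow d) = (\<integral>x. mixture m d w ?G x \<partial>lebesgue_pow d)"
  proof (rule integral_cong_AE)
    show "mixture m d w F \<in> borel_measurable (lebesgue_pow d)"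
      by (rule borel_measurable_integrable[OF mixture_mass(1)], rule int)
    show "mixture m d w ?G \<in> borel_measurable (lebesgue_pow d)"
      by (rule borel_measurable_integrable[OF mixture_mass(1)], rule Gint)
    have "AE x in lebesgue_pow d. x \<notin> unit_cube d \<longrightarrow> mixture m d w F x = 0"
      using supp by (simp add: supported_on_unit_cube_def)
    moreover have "AE x in lebesgue_pow d. x \<in> space (lebesgue_pow d)" by (rule AE_space)
    ultimately show "AE x in lebesgue_pow d. mixture m d w F x = mixture m d w ?G x"
    proof eventually_elim
      case (elim x)
      have ind: "mixture m d w ?G x = mixture m d w F x * (\<Prod>j\<in>{1..d}. indicator {0..1} (x j))"
        by (simp add: mixture_def prod.distrib sum_distrib_right mult.assoc)
      show ?case
      proof (cases "x \<in> unit_cube d")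
        case True
        then have "(\<Prod>j\<in>{1..d}. indicator {0..1} (x j)) = (1::real)"
          by (intro prod.neutral) (fastforce simp: unit_cube_def dest: PiE_mem)
        then show ?thesis by (simp add: ind)
      next
        case False
        then show ?thesis using elim by (simp add: ind)
      qed
    qed
  qed
  moreover have "(\<integral>x. mixture m d w F x \<partial>lebesgue_pow d) = (\<Sum>k\<in>{1..m}. w k * (\<Prod>j\<in>{1..d}. \<integral>x. F k j x \<partial>lborel))"
    by (rule mixture_mass(2)) (rule int(1))
  moreover have "(\<integral>x. mixture m d w ?G x \<partial>lebesgue_pow d) = (\<Sum>k\<in>{1..m}. w k * (\<Prod>j\<in>{1..d}. \<integral>x. ?G k j x \<partial>lborel))"
    by (rule mixture_mass(2)) (rule Gint)
  moreover have "(\<Sum>k\<in>{1..m}. w k * (\<Prod>j\<in>{1..d}. \<integral>x. F k j x \<partial>lborel)) = (\<Sum>k\<in>{1..m}. w k)"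
    by (rule sum.cong) (simp_all add: int(2))
  ultimately have "(\<Sum>k\<in>{1..m}. w k) = (\<Sum>k\<in>{1..m}. w k * (\<Prod>j\<in>{1..d}. c k j))"
    by (simp only: c_def l2_inner_def)
  then have "(\<Sum>k\<in>{1..m}. w k * (1 - (\<Prod>j\<in>{1..d}. c k j))) = 0"
    by (simp add: right_diff_distrib sum_subtractf)
  moreover have p1: "(\<Prod>j\<in>{1..d}. c k j) \<le> 1" if "k \<in> {1..m}" for k
    by (rule prod_le_1) (use c01 that in auto)
  ultimately have "w k * (1 - (\<Prod>j\<in>{1..d}. c k j)) = 0"
    using k w by (subst (asm) sum_nonneg_eq_0_iff) (auto simp: less_imp_le)
  then have "(\<Prod>j\<in>{1..d}. c k j) = 1" using w[OF k] by simp
  moreover have "(\<Prod>j\<in>{1..d}. c k j) = c k j * (\<Prod>j\<in>{1..d}-{j}. c k j)"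
    using j by (simp add: prod.remove)
  moreover have "(\<Prod>j\<in>{1..d}-{j}. c k j) \<le> 1"
    by (rule prod_le_1) (use c01 k in auto)
  ultimately have "1 \<le> c k j"
    using c01[OF k j] mult_left_le[of "\<Prod>j\<in>{1..d}-{j}. c k j" "c k j"] by simp
  then show ?thesis using c01[OF k j] by (simp add: c_def)
qed

section \<open>Dual families and approximate diagonalisation\<close>

text \<open>The matrix has entry \<open>Q k l\<close> in row \<open>l\<close> and column
  \<open>k\<close>, so the assumption says that its kernel is trivial. Both products with the
  inverse are recorded: the first makes the columns of \<open>U\<close> dual to those of
  \<open>Q\<close>, the second later shows that every component is matched. The index shift is
  needed because matrices start at 0.\<close>

lemma square_matrix_inverse:
  fixes Q :: "nat \<Rightarrow> nat \<Rightarrow> real"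
  assumes kernel: "\<And>u. (\<And>l. l \<in> {1..m} \<Longrightarrow> (\<Sum>k\<in>{1..m}. Q k l * u k) = 0) \<Longrightarrow> \<forall>k\<in>{1..m}. u k = 0"
  obtains U where
    "\<And>l l'. l \<in> {1..m} \<Longrightarrow> l' \<in> {1..m} \<Longrightarrow> (\<Sum>k\<in>{1..m}. Q k l * U k l') = of_bool (l = l')"
    "\<And>k k'. k \<in> {1..m} \<Longrightarrow> k' \<in> {1..m} \<Longrightarrow> (\<Sum>l\<in>{1..m}. U k l * Q k' l) = of_bool (k = k')"
proof -
  have shift: "(\<Sum>k\<in>{Suc 0..m}. h k) = (\<Sum>k = 0..<m. h (Suc k))" for h :: "nat \<Rightarrow> real"
    by (simp add: sum.atLeast_Suc_atMost_Suc_shift sum.atLeast1_atMost_eq[unfolded One_nat_def] atLeast0LessThan)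
  define A where "A = mat m m (\<lambda>(l, k). Q (Suc k) (Suc l))"
  have A: "A \<in> carrier_mat m m" by (simp add: A_def)
  have "v = 0\<^sub>v m" if v: "v \<in> carrier_vec m" and 0: "A *\<^sub>v v = 0\<^sub>v m" for v
  proof (rule eq_vecI)
    have "\<forall>k\<in>{1..m}. vec_index v (k - 1) = 0"
    proof (rule kernel)
      fix l assume l: "l \<in> {1..m}"
      then have l1: "l - 1 < m" "Suc (l - 1) = l" by auto
      then have "vec_index (A *\<^sub>v v) (l - 1) = 0" using 0 by simp
      then show "(\<Sum>k\<in>{1..m}. Q k l * vec_index v (k - 1)) = 0"
        using l l1 v by (simp add: shift A_def scalar_prod_def)
    qed
    then show "vec_index v i = vec_index (0\<^sub>v m) i" if "i < dim_vec (0\<^sub>v m)" for i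
      using that by (auto dest!: bspec[of _ _ "Suc i"])
  qed (use v in simp)
  then have "det A \<noteq> 0" using det_0_iff_vec_prod_zero[OF A] by auto
  from det_non_zero_imp_unit[OF A this, where 'b = unit]
  obtain B where B: "B \<in> carrier_mat m m" and BA: "B * A = 1\<^sub>m m" and AB: "A * B = 1\<^sub>m m"
    by (auto simp: Units_def ring_mat_def)
  define U where "U k l = B $$ (k - 1, l - 1)" for k l
  show ?thesis
  proof (rule that)
    fix l l' assume l: "l \<in> {1..m}" "l' \<in> {1..m}"
    then have l1: "l - 1 < m" "Suc (l - 1) = l" "l' - 1 < m" by auto
    have "(A * B) $$ (l - 1, l' - 1) = of_bool (l = l')" using AB l by auto
    then show "(\<Sum>k\<in>{1..m}. Q k l * U k l') = of_bool (l = l')"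
      using l l1 A B by (simp add: shift U_def A_def scalar_prod_def)
  next
    fix k k' assume k: "k \<in> {1..m}" "k' \<in> {1..m}"
    then have k1: "k - 1 < m" "k' - 1 < m" "Suc (k' - 1) = k'" by auto
    have "(B * A) $$ (k - 1, k' - 1) = of_bool (k = k')" using BA k by auto
    then show "(\<Sum>l\<in>{1..m}. U k l * Q k' l) = of_bool (k = k')"
      using k k1 A B by (simp add: shift U_def A_def scalar_prod_def)
  qed
qed

text \<open>The component of \<open>x\<close> orthogonal to \<open>y\<close> has inner product with
  \<open>x\<close> equal to its own squared length, which by incoherence is at least
  \<open>(1 - \<mu>\<^sup>2) * (norm x)\<^sup>2\<close>, hence at least \<open>1 - \<mu>\<close>.
  Dividing it by its squared length gives the desired vector.\<close>

lemma biorthogonal_pair: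
  fixes x y :: "'a :: real_inner"
  assumes x: "1 \<le> norm x" and y: "1 \<le> norm y" and \<mu>: "0 \<le> \<mu>" "\<mu> < 1"
    and xy: "\<bar>inner x y\<bar> \<le> \<mu> * norm x * norm y"
  obtains h where "inner h x = 1" "inner h y = 0" "norm h \<le> 1 / sqrt (1 - \<mu>)"
proof -
  define h where "h = x - (inner x y / inner y y) *\<^sub>R y"
  have yy: "0 < inner y y" using y by (metis inner_gt_zero_iff norm_zero not_one_le_zero)
  have hy: "inner h y = 0" using yy by (simp add: h_def inner_diff_left)
  have "inner h h = inner h x" using hy by (simp add: h_def inner_diff_right)
  then have hx: "inner h x = (norm h)\<^sup>2" by (simp add: power2_norm_eq_inner)
  have "(inner x y)\<^sup>2 \<le> (\<mu> * norm x * norm y)\<^sup>2"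
    using xy by (metis abs_ge_zero power2_abs power_mono)
  then have "(inner x y)\<^sup>2 / inner y y \<le> \<mu>\<^sup>2 * (norm x)\<^sup>2"
    using yy by (simp add: divide_simps power_mult_distrib power2_norm_eq_inner)
  moreover have "inner h x = (norm x)\<^sup>2 - (inner x y)\<^sup>2 / inner y y"
    unfolding h_def inner_diff_left power2_norm_eq_inner inner_scaleR_left inner_commute[of y x]
    by (simp add: power2_eq_square)
  moreover have "1 - \<mu> \<le> (1 - \<mu>\<^sup>2) * (norm x)\<^sup>2"
  proof -
    have "\<mu>\<^sup>2 \<le> \<mu>" using \<mu> by (simp add: power2_eq_square mult_left_le)
    moreover have "1 \<le> (norm x)\<^sup>2" using x by simp
    ultimately show ?thesis
      using mult_mono[of "1 - \<mu>" "1 - \<mu>\<^sup>2" 1 "(norm x)\<^sup>2"] \<mu> by simp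
  qed
  ultimately have h2: "1 - \<mu> \<le> (norm h)\<^sup>2" using hx by (simp add: algebra_simps)
  then have hpos: "0 < norm h" using \<mu> by (cases "norm h = 0") auto
  have "sqrt (1 - \<mu>) \<le> norm h" using h2 by (simp add: real_le_lsqrt)
  show ?thesis
  proof (rule that[of "h /\<^sub>R (norm h)\<^sup>2"])
    show "inner (h /\<^sub>R (norm h)\<^sup>2) x = 1" "inner (h /\<^sub>R (norm h)\<^sup>2) y = 0"
      using hx hy hpos by simp_all
    have "norm (h /\<^sub>R (norm h)\<^sup>2) = 1 / norm h"
      using hpos by (simp add: power2_eq_square divide_simps)
    also have "\<dots> \<le> 1 / sqrt (1 - \<mu>)"
      using \<open>sqrt (1 - \<mu>) \<le> norm h\<close> \<mu> hpos by (intro divide_left_mono) auto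
    finally show "norm (h /\<^sub>R (norm h)\<^sup>2) \<le> 1 / sqrt (1 - \<mu>)" .
  qed
qed

text \<open>\<open>S\<close> has one coordinate for each component other than \<open>k\<close>. A
  bijection \<open>t\<close> distributes these components over the coordinates, and
  \<open>a k j\<close> is chosen to be 1 on \<open>f k j\<close> and 0 on \<open>f (t j) j\<close>.
  On every other component some factor of the product then vanishes.\<close>

lemma dual_products:
  fixes f :: "nat \<Rightarrow> nat \<Rightarrow> 'a :: real_inner"
  assumes S: "finite S" "card S = m - 1" and \<mu>: "0 \<le> \<mu>" "\<mu> < 1"
    and f: "\<And>k j. k \<in> {1..m} \<Longrightarrow> j \<in> S \<Longrightarrow> 1 \<le> norm (f k j)"
    and inc: "\<And>k k' j. k \<in> {1..m} \<Longrightarrow> k' \<in> {1..m} \<Longrightarrow> k \<noteq> k' \<Longrightarrow> j \<in> S \<Longrightarrow>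
      \<bar>inner (f k j) (f k' j)\<bar> \<le> \<mu> * norm (f k j) * norm (f k' j)"
  obtains a where
    "\<And>k j. k \<in> {1..m} \<Longrightarrow> j \<in> S \<Longrightarrow> norm (a k j) \<le> 1 / sqrt (1 - \<mu>)"
    "\<And>k k'. k \<in> {1..m} \<Longrightarrow> k' \<in> {1..m} \<Longrightarrow> (\<Prod>j\<in>S. inner (a k j) (f k' j)) = of_bool (k = k')"
proof -
  have "\<exists>a. \<forall>j\<in>S. norm (a j) \<le> 1 / sqrt (1 - \<mu>) \<and> inner (a j) (f k j) = 1 \<and> inner (a j) (f (t j) j) = 0"
    if k: "k \<in> {1..m}" and t: "bij_betw t S ({1..m} - {k})" for k t
  proof (intro bchoice ballI)
    fix j assume j: "j \<in> S"
    then have "t j \<in> {1..m} - {k}" using bij_betwE[OF t] by blast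
    then obtain h where "inner h (f k j) = 1" "inner h (f (t j) j) = 0" "norm h \<le> 1 / sqrt (1 - \<mu>)"
      using biorthogonal_pair[OF f[OF k j] f[of "t j" j] \<mu> inc] k j by blast
    then show "\<exists>h. norm h \<le> 1 / sqrt (1 - \<mu>) \<and> inner h (f k j) = 1 \<and> inner h (f (t j) j) = 0"
      by blast
  qed
  moreover have "\<exists>t. bij_betw t S ({1..m} - {k})" if "k \<in> {1..m}" for k
    using S that by (intro finite_same_card_bij) auto
  ultimately have "\<forall>k\<in>{1..m}. \<exists>a. \<exists>t. bij_betw t S ({1..m} - {k}) \<and>
      (\<forall>j\<in>S. norm (a j) \<le> 1 / sqrt (1 - \<mu>) \<and> inner (a j) (f k j) = 1 \<and> inner (a j) (f (t j) j) = 0)"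
    by meson
  then obtain a where a: "\<And>k. k \<in> {1..m} \<Longrightarrow> \<exists>t. bij_betw t S ({1..m} - {k}) \<and>
      (\<forall>j\<in>S. norm (a k j) \<le> 1 / sqrt (1 - \<mu>) \<and> inner (a k j) (f k j) = 1 \<and> inner (a k j) (f (t j) j) = 0)"
    by metis
  show ?thesis
  proof (rule that[of a])
    show "norm (a k j) \<le> 1 / sqrt (1 - \<mu>)" if "k \<in> {1..m}" "j \<in> S" for k j
      using a that by blast
    fix k k' assume k: "k \<in> {1..m}" "k' \<in> {1..m}"
    obtain t where t: "bij_betw t S ({1..m} - {k})"
      "\<And>j. j \<in> S \<Longrightarrow> inner (a k j) (f k j) = 1" "\<And>j. j \<in> S \<Longrightarrow> inner (a k j) (f (t j) j) = 0"
      using a[OF k(1)] by blast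
    show "(\<Prod>j\<in>S. inner (a k j) (f k' j)) = of_bool (k = k')"
    proof (cases "k = k'")
      case False
      then obtain j where "j \<in> S" "t j = k'"
        using t(1) k by (metis DiffI bij_betw_iff_bijections singletonD)
      then show ?thesis using t(3) S False by (auto intro!: prod_zero)
    qed (use t in simp)
  qed
qed

section \<open>Perturbation of products and separation of incoherent vectors\<close>

lemma abs_prod_diff_le:
  fixes x y :: "'i \<Rightarrow> real"
  assumes "finite S" and xy: "\<And>j. j \<in> S \<Longrightarrow> \<bar>x j - y j\<bar> \<le> \<delta>" and y: "\<And>j. j \<in> S \<Longrightarrow> \<bar>y j\<bar> \<le> M"
    and "0 \<le> \<delta>" "0 \<le> M"
  shows "\<bar>(\<Prod>j\<in>S. x j) - (\<Prod>j\<in>S. y j)\<bar> \<le> (M + \<delta>) ^ card S - M ^ card S"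
  using assms(1) xy y
proof (induction S rule: finite_induct)
  case (insert i S)
  let ?X = "\<Prod>j\<in>S. x j" and ?Y = "\<Prod>j\<in>S. y j"
  have X: "\<bar>?X\<bar> \<le> (M + \<delta>) ^ card S"
  proof -
    have "\<bar>x j\<bar> \<le> M + \<delta>" if "j \<in> S" for j
      using insert.prems(1)[of j] insert.prems(2)[of j] that by auto
    then have "(\<Prod>j\<in>S. \<bar>x j\<bar>) \<le> (\<Prod>j\<in>S. M + \<delta>)" by (intro prod_mono) auto
    then show ?thesis by (simp add: abs_prod)
  qed
  \<comment> \<open>One factor is replaced at a time; the bounds add up to the difference of the
    products in the extreme case \<open>y j = M\<close> and
    \<open>x j = M + \<delta>\<close>.\<close>
  have "x i * ?X - y i * ?Y = (x i - y i) * ?X + y i * (?X - ?Y)" by (simp add: algebra_simps)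
  also have "\<bar>\<dots>\<bar> \<le> \<bar>x i - y i\<bar> * \<bar>?X\<bar> + \<bar>y i\<bar> * \<bar>?X - ?Y\<bar>"
    by (metis abs_mult abs_triangle_ineq)
  also have "\<dots> \<le> \<delta> * (M + \<delta>) ^ card S + M * ((M + \<delta>) ^ card S - M ^ card S)"
    using insert X assms(4,5) by (intro add_mono mult_mono) auto
  finally show ?case using insert.hyps by (simp add: algebra_simps)
qed simp

text \<open>Since \<open>1 \<le> R\<close>, the sum \<open>R + \<eta>\<close> is at most
  \<open>R * (1 + \<eta>)\<close>, which reduces the claim to \<open>R = 1\<close>. There
  \<open>(1 + \<eta>) ^ n \<le> exp (n * \<eta>)\<close>, and the quadratic bound for
  \<open>exp\<close> on the unit interval applies.\<close>

lemma power_add_diff_le: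
  fixes R \<eta> :: real
  assumes R: "1 \<le> R" and \<eta>: "0 \<le> \<eta>" "real n * \<eta> \<le> 1"
  shows "(R + \<eta>) ^ n - R ^ n \<le> 2 * real n * \<eta> * R ^ n"
proof -
  have "(1 + \<eta>) ^ n \<le> exp \<eta> ^ n" using \<eta> by (intro power_mono) auto
  also have "\<dots> = exp (real n * \<eta>)" by (simp add: exp_of_nat_mult)
  also have "\<dots> \<le> 1 + real n * \<eta> + (real n * \<eta>)\<^sup>2" using \<eta> by (intro exp_bound) auto
  also have "(real n * \<eta>)\<^sup>2 \<le> real n * \<eta>" using \<eta> by (simp add: power2_eq_square mult_left_le)
  finally have 1: "(1 + \<eta>) ^ n \<le> 1 + 2 * real n * \<eta>" by (simp add: mult.commute)
  have "(R + \<eta>) ^ n \<le> (R * (1 + \<eta>)) ^ n"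
    using R \<eta> by (intro power_mono) (auto simp: distrib_left mult_le_cancel_right1)
  also have "\<dots> \<le> R ^ n * (1 + 2 * real n * \<eta>)"
    unfolding power_mult_distrib using 1 R by (intro mult_left_mono) auto
  finally show ?thesis by (simp add: algebra_simps)
qed

text \<open>Incoherence bounds the squared distance from below by \<open>(1 - \<mu>) * ((norm
  x)\<^sup>2 + (norm y)\<^sup>2) + \<mu> * (norm x - norm y)\<^sup>2\<close>.\<close>

lemma incoherent_separation:
  fixes x y :: "'a :: real_inner"
  assumes x: "1 \<le> norm x" and y: "1 \<le> norm y" and \<mu>: "0 \<le> \<mu>" "\<mu> < 1"
    and xy: "\<bar>inner x y\<bar> \<le> \<mu> * norm x * norm y"
  shows "sqrt (1 - \<mu>) \<le> norm (x - y)"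
proof -
  have "(norm (x - y))\<^sup>2 = (norm x)\<^sup>2 + (norm y)\<^sup>2 - 2 * inner x y"
    by (simp add: power2_norm_eq_inner inner_diff inner_commute)
  moreover have "(norm x)\<^sup>2 + (norm y)\<^sup>2 - 2 * (\<mu> * norm x * norm y)
      = (1 - \<mu>) * ((norm x)\<^sup>2 + (norm y)\<^sup>2) + \<mu> * (norm x - norm y)\<^sup>2"
    by (simp add: power2_eq_square algebra_simps)
  moreover have "0 \<le> \<mu> * (norm x - norm y)\<^sup>2" using \<mu> by simp
  moreover have "(1 - \<mu>) * 1 \<le> (1 - \<mu>) * ((norm x)\<^sup>2 + (norm y)\<^sup>2)"
  proof (intro mult_left_mono)
    have "1 \<le> (norm x)\<^sup>2" using x by simp
    then show "1 \<le> (norm x)\<^sup>2 + (norm y)\<^sup>2" by (smt (verit) zero_le_power2)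
  qed (use \<mu> in auto)
  moreover have "inner x y \<le> \<mu> * norm x * norm y" using xy by simp
  ultimately have "1 - \<mu> \<le> (norm (x - y))\<^sup>2" by simp
  then show ?thesis by (simp add: real_le_lsqrt)
qed

text \<open>
  Contracting the approximate identity \<open>\<delta>\<^sub>k\<^sub>k\<^sub>' w\<^sub>k x\<^sub>k = \<Sum>\<^sub>l v\<^sub>l P\<^sub>k\<^sub>l Q\<^sub>k\<^sub>'\<^sub>l y\<^sub>l\<close> with a vector \<open>u\<close> dual to the
  \<open>l\<close>-th column of \<open>Q\<close> leaves \<open>w\<^sub>k u\<^sub>k x\<^sub>k = v\<^sub>l P\<^sub>k\<^sub>l y\<^sub>l\<close> up to an error. As in Gershgorin's theorem, the row
  in which \<open>u\<close> is largest identifies the direction of \<open>y\<^sub>l\<close>.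
\<close>

lemma contracted_error:
  fixes x y :: "nat \<Rightarrow> 'a :: real_inner"
  assumes E: "\<And>k k'. k \<in> {1..m} \<Longrightarrow> k' \<in> {1..m} \<Longrightarrow>
      norm ((of_bool (k = k') * w k) *\<^sub>R x k - (\<Sum>l\<in>{1..m}. (v l * P k l * Q k' l) *\<^sub>R y l)) \<le> \<kappa>"
    and k: "k \<in> {1..m}" and U: "\<And>k. k \<in> {1..m} \<Longrightarrow> \<bar>u k\<bar> \<le> b"
  shows "norm ((w k * u k) *\<^sub>R x k - (\<Sum>l\<in>{1..m}. (v l * P k l * (\<Sum>k'\<in>{1..m}. Q k' l * u k')) *\<^sub>R y l))
    \<le> real m * \<kappa> * b"
proof -
  have "(w k * u k) *\<^sub>R x k = (\<Sum>k'\<in>{1..m}. u k' *\<^sub>R (of_bool (k = k') * w k) *\<^sub>R x k)"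
  proof -
    have "(\<Sum>k'\<in>{1..m}. u k' *\<^sub>R (of_bool (k = k') * w k) *\<^sub>R x k)
        = (\<Sum>k'\<in>{1..m}. if k' = k then (w k * u k) *\<^sub>R x k else 0)"
      by (intro sum.cong) (auto simp: mult.commute)
    then show ?thesis using k by simp
  qed
  moreover have "(\<Sum>l\<in>{1..m}. (v l * P k l * (\<Sum>k'\<in>{1..m}. Q k' l * u k')) *\<^sub>R y l)
      = (\<Sum>k'\<in>{1..m}. u k' *\<^sub>R (\<Sum>l\<in>{1..m}. (v l * P k l * Q k' l) *\<^sub>R y l))"
    by (simp add: sum_distrib_left scaleR_sum_left scaleR_sum_right mult_ac) (rule sum.swap)
  ultimately have "(w k * u k) *\<^sub>R x k - (\<Sum>l\<in>{1..m}. (v l * P k l * (\<Sum>k'\<in>{1..m}. Q k' l * u k')) *\<^sub>R y l)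
      = (\<Sum>k'\<in>{1..m}. u k' *\<^sub>R ((of_bool (k = k') * w k) *\<^sub>R x k - (\<Sum>l\<in>{1..m}. (v l * P k l * Q k' l) *\<^sub>R y l)))"
    by (simp add: scaleR_diff_right sum_subtractf)
  also have "norm \<dots> \<le> (\<Sum>k'\<in>{1..m}. b * \<kappa>)"
  proof (rule sum_norm_le)
    fix k' assume k': "k' \<in> {1..m}"
    then show "norm (u k' *\<^sub>R ((of_bool (k = k') * w k) *\<^sub>R x k - (\<Sum>l\<in>{1..m}. (v l * P k l * Q k' l) *\<^sub>R y l))) \<le> b * \<kappa>"
      unfolding norm_scaleR using U[OF k'] E[OF k k']
      by (intro mult_mono) (auto intro: order_trans[OF abs_ge_zero])
  qed
  finally show ?thesis by (simp add: mult_ac)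
qed

lemma finite_argmax:
  fixes u :: "nat \<Rightarrow> real"
  assumes "1 \<le> m"
  obtains t where "t \<in> {1..m}" "\<And>k. k \<in> {1..m} \<Longrightarrow> u k \<le> u t"
proof -
  have "Max (u ` {1..m}) \<in> u ` {1..m}" using assms by (intro Max_in) auto
  then obtain t where "t \<in> {1..m}" "u t = Max (u ` {1..m})" by force
  then show ?thesis using that by (metis Max_ge finite_atLeastAtMost finite_imageI imageI)
qed

text \<open>If \<open>u\<close> annihilates all columns of \<open>Q\<close>, contraction leaves only
  the vectors \<open>(w k * u k) *\<^sub>R x k\<close>, of norm at most
  \<open>m * \<kappa> * \<bar>u t\<bar>\<close> with \<open>\<bar>u t\<bar>\<close> the largest
  entry. For \<open>k = t\<close> the norm is at least \<open>\<zeta> * \<bar>u t\<bar>\<close>, so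
  \<open>u t = 0\<close>. This makes \<open>Q\<close> invertible.\<close>

lemma contracted_kernel:
  fixes x y :: "nat \<Rightarrow> 'a :: real_inner"
  assumes E: "\<And>k k'. k \<in> {1..m} \<Longrightarrow> k' \<in> {1..m} \<Longrightarrow>
      norm ((of_bool (k = k') * w k) *\<^sub>R x k - (\<Sum>l\<in>{1..m}. (v l * P k l * Q k' l) *\<^sub>R y l)) \<le> \<kappa>"
    and x: "\<And>k. k \<in> {1..m} \<Longrightarrow> 1 \<le> norm (x k)"
    and w: "\<And>k. k \<in> {1..m} \<Longrightarrow> \<zeta> \<le> w k" and small: "0 < \<zeta>" "real m * \<kappa> < \<zeta>"
    and u: "\<And>l. l \<in> {1..m} \<Longrightarrow> (\<Sum>k\<in>{1..m}. Q k l * u k) = 0"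
  shows "\<forall>k\<in>{1..m}. u k = 0"
proof (cases "1 \<le> m")
  case True
  obtain t where t: "t \<in> {1..m}" "\<And>k. k \<in> {1..m} \<Longrightarrow> \<bar>u k\<bar> \<le> \<bar>u t\<bar>"
    using finite_argmax[OF True, of "\<lambda>k. \<bar>u k\<bar>"] by metis
  have "norm ((w t * u t) *\<^sub>R x t) \<le> real m * \<kappa> * \<bar>u t\<bar>"
    using contracted_error[where u = u, OF E t(1) t(2)] u by simp
  moreover have "\<zeta> * \<bar>u t\<bar> * 1 \<le> w t * \<bar>u t\<bar> * norm (x t)"
    using w[OF t(1)] x[OF t(1)] small by (intro mult_mono) auto
  ultimately have "(\<zeta> - real m * \<kappa>) * \<bar>u t\<bar> \<le> 0"
    using w[OF t(1)] small by (simp add: abs_mult algebra_simps)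
  then have "u t = 0" using small by (simp add: mult_le_0_iff)
  then show ?thesis using t(2) by force
qed auto

text \<open>\<open>z\<close> is \<open>y l\<close> scaled to \<open>inner z e = 1\<close>, and
  pairing with \<open>e\<close> eliminates the unknown coefficient \<open>v l * P k l\<close>. The
  second conclusion gives the match in the dominant row \<open>t\<close>; the third forces
  \<open>u k\<close> to be small in rows where \<open>x k\<close> is far from \<open>z\<close>; the
  last bounds \<open>u t\<close> by a multiple of \<open>v l\<close>.\<close>

lemma contracted_estimate:
  fixes x y :: "nat \<Rightarrow> 'a :: real_inner"
  assumes E: "\<And>k k'. k \<in> {1..m} \<Longrightarrow> k' \<in> {1..m} \<Longrightarrow>
      norm ((of_bool (k = k') * w k) *\<^sub>R x k - (\<Sum>l\<in>{1..m}. (v l * P k l * Q k' l) *\<^sub>R y l)) \<le> \<kappa>"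
    and e: "norm e \<le> 1" and xe: "\<And>k. k \<in> {1..m} \<Longrightarrow> inner (x k) e = 1"
    and xR: "\<And>k. k \<in> {1..m} \<Longrightarrow> norm (x k) \<le> R" and R: "1 \<le> R"
    and w: "\<And>k. k \<in> {1..m} \<Longrightarrow> \<zeta> \<le> w k"
    and small: "0 < \<zeta>" "0 \<le> \<kappa>" "2 * real m * \<kappa> \<le> \<zeta>"
    and l: "l \<in> {1..m}" and ye: "0 \<le> inner (y l) e"
    and u: "\<And>l'. l' \<in> {1..m} \<Longrightarrow> (\<Sum>k\<in>{1..m}. Q k l' * u k) = of_bool (l' = l)"
    and t: "t \<in> {1..m}" "\<And>k. k \<in> {1..m} \<Longrightarrow> \<bar>u k\<bar> \<le> \<bar>u t\<bar>"
  defines "z \<equiv> y l /\<^sub>R inner (y l) e"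
  shows "0 < inner (y l) e"
    "norm (x t - z) \<le> 4 * real m * \<kappa> * R / \<zeta>"
    "\<And>k. k \<in> {1..m} \<Longrightarrow> \<zeta> * \<bar>u k\<bar> * norm (x k - z) \<le> real m * \<kappa> * \<bar>u t\<bar> * (1 + norm z)"
    "\<zeta> * \<bar>u t\<bar> \<le> 2 * \<bar>v l * inner (y l) e * P t l\<bar>"
proof -
  let ?b = "real m * \<kappa> * \<bar>u t\<bar>"
  define N where "N k = (w k * u k) *\<^sub>R x k - (v l * P k l) *\<^sub>R y l" for k
  have N: "norm (N k) \<le> ?b" if k: "k \<in> {1..m}" for k
  proof -
    have "(\<Sum>l'\<in>{1..m}. (v l' * P k l' * (\<Sum>k'\<in>{1..m}. Q k' l' * u k')) *\<^sub>R y l')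
        = (\<Sum>l'\<in>{1..m}. if l' = l then (v l * P k l) *\<^sub>R y l else 0)"
    proof (intro sum.cong refl)
      fix l' assume "l' \<in> {1..m}"
      then show "(v l' * P k l' * (\<Sum>k'\<in>{1..m}. Q k' l' * u k')) *\<^sub>R y l'
          = (if l' = l then (v l * P k l) *\<^sub>R y l else 0)"
        by (subst u) auto
    qed
    then show ?thesis using contracted_error[where u = u, OF E k t(2)] l by (simp add: N_def)
  qed
  have Ne: "\<bar>inner (N k) e\<bar> \<le> ?b" if k: "k \<in> {1..m}" for k
    using N[OF k] e Cauchy_Schwarz_ineq2[of "N k" e] mult_left_le[of "norm e" "norm (N k)"] by simp
  have inner_N: "inner (N k) e = w k * u k - v l * inner (y l) e * P k l" if "k \<in> {1..m}" for k
    using xe[OF that] by (simp add: N_def inner_diff_left)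
  have ut: "0 < \<bar>u t\<bar>"
  proof (rule ccontr)
    assume "\<not> 0 < \<bar>u t\<bar>"
    then have "(\<Sum>k\<in>{1..m}. Q k l * u k) = 0" using t(2) by (intro sum.neutral) force
    then show False using u[OF l] by simp
  qed
  have "\<zeta> * \<bar>u t\<bar> \<le> \<bar>w t * u t\<bar>"
    unfolding abs_mult using w[OF t(1)] small by (intro mult_right_mono) auto
  moreover have b: "2 * ?b \<le> \<zeta> * \<bar>u t\<bar>"
    using mult_right_mono[OF small(3), of "\<bar>u t\<bar>"] by simp
  moreover have "\<bar>w t * u t\<bar> \<le> \<bar>inner (N t) e\<bar> + \<bar>v l * inner (y l) e * P t l\<bar>"
    using inner_N[OF t(1)] by simp
  ultimately show 4: "\<zeta> * \<bar>u t\<bar> \<le> 2 * \<bar>v l * inner (y l) e * P t l\<bar>"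
    using Ne[OF t(1)] by linarith
  have "0 < \<zeta> * \<bar>u t\<bar>" using small ut by simp
  then have "inner (y l) e \<noteq> 0" using 4 by auto
  then show pos: "0 < inner (y l) e" using ye by simp
  then have y: "y l = inner (y l) e *\<^sub>R z" by (simp add: z_def)
  show 3: "\<zeta> * \<bar>u k\<bar> * norm (x k - z) \<le> ?b * (1 + norm z)" if k: "k \<in> {1..m}" for k
  proof -
    \<comment> \<open>As \<open>inner (N k) e\<close> is the difference of the two scalar
      coefficients, subtracting this multiple of \<open>z\<close> changes the coefficient of
      \<open>z\<close> to \<open>- (w k * u k)\<close>.\<close>
    have "(w k * u k) *\<^sub>R (x k - z) = N k - inner (N k) e *\<^sub>R z"
    proof -
      have "N k = (w k * u k) *\<^sub>R x k - (v l * P k l) *\<^sub>R inner (y l) e *\<^sub>R z"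
        using y by (simp add: N_def)
      then show ?thesis by (simp add: inner_N[OF k] algebra_simps)
    qed
    then have "norm ((w k * u k) *\<^sub>R (x k - z)) \<le> norm (N k) + norm (inner (N k) e *\<^sub>R z)"
      by (metis norm_triangle_ineq4)
    also have "\<dots> \<le> ?b + ?b * norm z"
      unfolding norm_scaleR real_norm_def using N[OF k] Ne[OF k]
      by (intro add_mono mult_right_mono) auto
    finally have "\<bar>w k * u k\<bar> * norm (x k - z) \<le> ?b * (1 + norm z)"
      unfolding norm_scaleR by (simp add: distrib_left)
    moreover have "\<zeta> * \<bar>u k\<bar> * norm (x k - z) \<le> \<bar>w k * u k\<bar> * norm (x k - z)"
      unfolding abs_mult using w[OF k] small by (intro mult_right_mono) auto
    ultimately show ?thesis by linarith
  qed
  have "\<zeta> * \<bar>u t\<bar> * norm (x t - z) \<le> ?b * (1 + norm z)" by (rule 3[OF t(1)])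
  then have "\<bar>u t\<bar> * (\<zeta> * norm (x t - z)) \<le> \<bar>u t\<bar> * (real m * \<kappa> * (1 + norm z))"
    by (simp add: mult_ac)
  then have "\<zeta> * norm (x t - z) \<le> real m * \<kappa> * (1 + norm z)"
    using ut by (simp only: mult_le_cancel_left_pos)
  \<comment> \<open>\<open>norm z\<close> is bounded in terms of the very distance being estimated;
    since \<open>m * \<kappa> \<le> \<zeta> / 2\<close>, that term is absorbed on the left.\<close>
  also have "\<dots> \<le> real m * \<kappa> * (2 * R + norm (x t - z))"
  proof (intro mult_left_mono)
    have "norm z \<le> norm (x t) + norm (x t - z)" by (metis norm_minus_commute norm_triangle_sub)
    then show "1 + norm z \<le> 2 * R + norm (x t - z)" using xR[OF t(1)] R by simp
  qed (use small in auto)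
  also have "\<dots> \<le> 2 * real m * \<kappa> * R + \<zeta> / 2 * norm (x t - z)"
  proof -
    have "real m * \<kappa> * norm (x t - z) \<le> \<zeta> / 2 * norm (x t - z)"
      using small by (intro mult_right_mono) auto
    then show ?thesis by (simp add: algebra_simps)
  qed
  finally show "norm (x t - z) \<le> 4 * real m * \<kappa> * R / \<zeta>"
    using small by (simp add: field_simps)
qed

section \<open>Stability of product decompositions\<close>

lemma prod_split3:
  fixes p :: "nat \<Rightarrow> 'c :: comm_monoid_mult"
  assumes "finite D" "S \<subseteq> D" "T \<subseteq> D" "S \<inter> T = {}" "i \<in> D" "i \<notin> S" "i \<notin> T"
  shows "prod p D = prod p S * prod p T * p i * prod p (D - S - T - {i})"
proof -
  have "prod p D = prod p (S \<union> (T \<union> insert i (D - S - T - {i})))"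
    using assms by (intro prod.cong) auto
  also have "\<dots> = prod p S * prod p (T \<union> insert i (D - S - T - {i}))"
    using assms by (intro prod.union_disjoint) (auto intro: finite_subset)
  also have "prod p (T \<union> insert i (D - S - T - {i})) = prod p T * prod p (insert i (D - S - T - {i}))"
    using assms by (intro prod.union_disjoint) (auto intro: finite_subset)
  also have "prod p (insert i (D - S - T - {i})) = p i * prod p (D - S - T - {i})"
    using assms by (intro prod.insert) auto
  finally show ?thesis by (simp add: mult.assoc)
qed

lemma norm_le_of_inner_le:
  fixes x :: "'a :: real_inner"
  assumes "\<And>y. inner x y \<le> c * norm y" and "0 \<le> c"
  shows "norm x \<le> c"
proof (cases "x = 0")
  case False
  have "norm x * norm x \<le> c * norm x"
    using assms(1)[of x] by (simp flip: power2_norm_eq_inner add: power2_eq_square)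
  then show ?thesis using False by simp
qed (use assms in simp)

text \<open>
  Components are vectors of an arbitrary inner product space; \<open>e\<close> stands for the indicator of the unit interval,
  and \<open>close\<close> is all that is used of the \<open>L\<^sup>2\<close> distance of the two mixtures.
\<close>

locale close_product_mixtures =
  fixes m d :: nat and w w' :: "nat \<Rightarrow> real" and f g :: "nat \<Rightarrow> nat \<Rightarrow> 'a :: real_inner"
    and e :: 'a and \<mu> \<zeta> R \<epsilon> :: real
  assumes m: "2 \<le> m" and d: "2 * m - 1 \<le> d"
    and \<mu>: "0 \<le> \<mu>" "\<mu> < 1" and \<zeta>: "0 < \<zeta>" and R: "1 \<le> R" and \<epsilon>: "0 \<le> \<epsilon>"
    and norm_e: "norm e = 1"
    and w: "\<And>k. k \<in> {1..m} \<Longrightarrow> \<zeta> \<le> w k" "(\<Sum>k\<in>{1..m}. w k) = 1"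
    and w': "\<And>l. l \<in> {1..m} \<Longrightarrow> 0 \<le> w' l" "(\<Sum>l\<in>{1..m}. w' l) = 1"
    and f_e: "\<And>k j. k \<in> {1..m} \<Longrightarrow> j \<in> {1..d} \<Longrightarrow> inner (f k j) e = 1"
    and f_R: "\<And>k j. k \<in> {1..m} \<Longrightarrow> j \<in> {1..d} \<Longrightarrow> norm (f k j) \<le> R"
    and f_incoherent: "\<And>k k' j. k \<in> {1..m} \<Longrightarrow> k' \<in> {1..m} \<Longrightarrow> k \<noteq> k' \<Longrightarrow> j \<in> {1..d} \<Longrightarrow>
      \<bar>inner (f k j) (f k' j)\<bar> \<le> \<mu> * norm (f k j) * norm (f k' j)"
    and g_e: "\<And>l j. l \<in> {1..m} \<Longrightarrow> j \<in> {1..d} \<Longrightarrow> 0 \<le> inner (g l j) e"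
      "\<And>l j. l \<in> {1..m} \<Longrightarrow> j \<in> {1..d} \<Longrightarrow> inner (g l j) e \<le> 1"
    and g_R: "\<And>l j. l \<in> {1..m} \<Longrightarrow> j \<in> {1..d} \<Longrightarrow> norm (g l j) \<le> R"
    and close: "\<And>h. \<bar>(\<Sum>k\<in>{1..m}. w k * (\<Prod>j\<in>{1..d}. inner (f k j) (h j)))
        - (\<Sum>l\<in>{1..m}. w' l * (\<Prod>j\<in>{1..d}. inner (g l j) (h j)))\<bar> \<le> \<epsilon> * (\<Prod>j\<in>{1..d}. norm (h j))"
    and small: "64 * (real m)\<^sup>2 * R ^ (2 * m) * \<epsilon> \<le> \<zeta>\<^sup>2 * (1 - \<mu>) ^ (2 * m - 1)"
begin

text \<open>
  \<open>\<alpha>\<close> bounds the norm of the dual product functions of a block, \<open>\<kappa>\<close> the error that remains after testing against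
  duals on two blocks, and \<open>\<eta>\<close> the distance of matched normalised components; all errors of weights are multiples
  of \<open>X\<close>.
\<close>

definition s :: real where "s = 1 - \<mu>"
definition \<alpha> :: real where "\<alpha> = (1 / sqrt s) ^ (m - 1)"
definition \<kappa> :: real where "\<kappa> = \<alpha>\<^sup>2 * \<epsilon>"
definition \<eta> :: real where "\<eta> = 4 * real m * \<kappa> * R / \<zeta>"
definition X :: real where "X = (real m)\<^sup>2 * \<alpha> ^ 3 * R ^ m * \<epsilon> / \<zeta>"

section \<open>Numerical consequences of the smallness assumption\<close>

lemma s: "0 < s" "s \<le> 1"
  using \<mu> by (auto simp: s_def)

lemma sqrt_s: "0 < sqrt s" "sqrt s \<le> 1" "s \<le> sqrt s"
proof -
  show "0 < sqrt s" "sqrt s \<le> 1" using s by auto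
  then have "sqrt s * sqrt s \<le> sqrt s" by (intro mult_left_le) auto
  moreover have "sqrt s * sqrt s = s" using s by simp
  ultimately show "s \<le> sqrt s" by linarith
qed

lemma \<alpha>: "1 \<le> \<alpha>"
  unfolding \<alpha>_def using sqrt_s by (intro one_le_power) (auto simp: divide_simps)

lemma \<alpha>_sq: "\<alpha>\<^sup>2 = 1 / s ^ (m - 1)"
proof -
  have "\<alpha>\<^sup>2 = ((1 / sqrt s)\<^sup>2) ^ (m - 1)" by (simp add: \<alpha>_def mult.commute flip: power_mult)
  also have "(1 / sqrt s)\<^sup>2 = 1 / s" using s by (simp add: power_divide)
  finally show ?thesis by (simp add: power_divide)
qed

text \<open>The factor \<open>\<alpha> ^ 4\<close> cancels all but one of the factors
  \<open>s\<close> in the smallness assumption.\<close>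

lemma \<alpha>_4: "\<alpha> ^ 4 * s ^ (2 * m - 1) = s"
proof -
  have "\<alpha> ^ 4 = (\<alpha>\<^sup>2)\<^sup>2" by simp
  moreover have "s ^ (2 * m - 1) = (s ^ (m - 1))\<^sup>2 * s"
  proof -
    have "2 * m - 1 = (m - 1) * 2 + 1" using m by simp
    then show ?thesis by (simp only: power_add power_mult power_one_right)
  qed
  ultimately show ?thesis using s by (simp add: \<alpha>_sq power_divide)
qed

lemma \<zeta>_le_1: "\<zeta> \<le> 1"
proof -
  have "w 1 \<le> (\<Sum>k\<in>{1..m}. w k)"
    using m w(1) \<zeta> by (intro member_le_sum) (auto intro: order_trans[OF less_imp_le])
  then show ?thesis using w m by (metis atLeastAtMost_iff order.trans one_le_numeral order_refl)
qed

lemma \<kappa>: "0 \<le> \<kappa>" "\<epsilon> \<le> \<kappa>"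
proof -
  have "1 \<le> \<alpha>\<^sup>2" using \<alpha> by simp
  then show "0 \<le> \<kappa>" "\<epsilon> \<le> \<kappa>" using \<epsilon> mult_right_mono[of 1 "\<alpha>\<^sup>2" \<epsilon>] by (simp_all add: \<kappa>_def)
qed

lemma small4: "64 * (real m)\<^sup>2 * \<alpha> ^ 4 * R ^ (2 * m) * \<epsilon> \<le> \<zeta>\<^sup>2 * s"
proof -
  have "\<alpha> ^ 4 * (64 * (real m)\<^sup>2 * R ^ (2 * m) * \<epsilon>) \<le> \<alpha> ^ 4 * (\<zeta>\<^sup>2 * s ^ (2 * m - 1))"
    using small \<alpha> by (intro mult_left_mono) (auto simp: s_def)
  also have "\<dots> = \<zeta>\<^sup>2 * (\<alpha> ^ 4 * s ^ (2 * m - 1))" by (simp only: mult_ac)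
  also have "\<dots> = \<zeta>\<^sup>2 * s" by (simp only: \<alpha>_4)
  finally show ?thesis by (simp only: mult_ac)
qed

lemma X: "0 \<le> X" "64 * X \<le> \<zeta>" "\<kappa> \<le> X" "real m * \<eta> \<le> 4 * X"
proof -
  show "0 \<le> X" using \<epsilon> R \<alpha> \<zeta> by (simp add: X_def)
  have mm: "real m \<le> (real m)\<^sup>2" "1 \<le> (real m)\<^sup>2"
    using m by (simp add: power2_eq_square, intro one_le_power, simp)
  have "64 * (real m)\<^sup>2 * \<alpha> ^ 3 * R ^ m * \<epsilon> \<le> 64 * (real m)\<^sup>2 * \<alpha> ^ 4 * R ^ (2 * m) * \<epsilon>"
    using \<epsilon> R \<alpha> by (intro mult_right_mono mult_mono power_increasing) auto
  also have "\<dots> \<le> \<zeta>\<^sup>2" using small4 s mult_left_le[of s "\<zeta>\<^sup>2"] by simp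
  finally show "64 * X \<le> \<zeta>" using \<zeta> by (simp add: X_def field_simps power2_eq_square)
  \<comment> \<open>The denominator 1 is there to be compared with \<open>\<zeta> \<le> 1\<close> by
    monotonicity of fractions.\<close>
  have 23: "1 * \<alpha>\<^sup>2 * R * \<epsilon> / 1 \<le> (real m)\<^sup>2 * \<alpha> ^ 3 * R ^ m * \<epsilon> / \<zeta>"
    using mm \<epsilon> R \<alpha> \<zeta> \<zeta>_le_1 m
    by (intro frac_le mult_right_mono mult_mono power_increasing self_le_power) (auto intro!: mult_nonneg_nonneg)
  moreover have "\<alpha>\<^sup>2 * \<epsilon> \<le> \<alpha>\<^sup>2 * R * \<epsilon>"
    using R \<epsilon> by (intro mult_right_mono) (auto simp: mult_le_cancel_left1)
  ultimately show "\<kappa> \<le> X" by (simp add: X_def \<kappa>_def)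
  have "(real m)\<^sup>2 * \<alpha>\<^sup>2 * R * \<epsilon> \<le> (real m)\<^sup>2 * \<alpha> ^ 3 * R ^ m * \<epsilon>"
    using \<epsilon> R \<alpha> m
    by (intro mult_right_mono mult_mono power_increasing self_le_power) (auto intro!: mult_nonneg_nonneg)
  then have "4 * ((real m)\<^sup>2 * \<alpha>\<^sup>2 * R * \<epsilon>) / \<zeta> \<le> 4 * ((real m)\<^sup>2 * \<alpha> ^ 3 * R ^ m * \<epsilon>) / \<zeta>"
    using \<zeta> by (intro divide_right_mono) auto
  then show "real m * \<eta> \<le> 4 * X"
    by (simp add: X_def \<eta>_def \<kappa>_def power2_eq_square mult_ac)
qed

text \<open>The third bound prevents two components, which are at distance at least
  \<open>sqrt s\<close>, from both being within \<open>\<eta>\<close> of one vector. The fourth and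
  fifth are the smallness conditions of \<open>contracted_estimate\<close> and
  \<open>contracted_kernel\<close>. In the last, \<open>\<alpha> * R ^ (m - 1)\<close> is the bound
  for coefficients against duals; it makes the matching onto.\<close>

lemma \<eta>: "0 \<le> \<eta>" "\<eta> \<le> 1" "3 * \<eta> \<le> sqrt s" "2 * real m * \<kappa> \<le> \<zeta>" "real m * \<kappa> < \<zeta>"
  "24 * real m * \<kappa> * R * (\<alpha> * R ^ (m - 1))\<^sup>2 \<le> \<zeta>\<^sup>2 * sqrt s"
proof -
  show 0: "0 \<le> \<eta>" using \<kappa> R \<zeta> by (simp add: \<eta>_def)
  have "\<alpha>\<^sup>2 * \<alpha>\<^sup>2 = \<alpha> ^ 4" by (simp flip: power_add)
  moreover have "R * (R ^ (m - 1))\<^sup>2 = R ^ (2 * m - 1)"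
  proof -
    have "2 * m - 1 = Suc ((m - 1) * 2)" using m by simp
    then show ?thesis by (simp only: power_Suc power_mult)
  qed
  ultimately have "24 * real m * \<kappa> * R * (\<alpha> * R ^ (m - 1))\<^sup>2 = 24 * real m * \<alpha> ^ 4 * R ^ (2 * m - 1) * \<epsilon>"
    by (simp only: \<kappa>_def power_mult_distrib) (simp add: mult_ac)
  also have "\<dots> \<le> 64 * (real m)\<^sup>2 * \<alpha> ^ 4 * R ^ (2 * m) * \<epsilon>"
    using \<epsilon> R \<alpha> m by (intro mult_right_mono mult_mono power_increasing) (auto simp: power2_eq_square)
  also have "\<dots> \<le> \<zeta>\<^sup>2 * sqrt s"
    using small4 sqrt_s(3) by (meson mult_left_mono order_trans zero_le_power2)
  finally show 24: "24 * real m * \<kappa> * R * (\<alpha> * R ^ (m - 1))\<^sup>2 \<le> \<zeta>\<^sup>2 * sqrt s" .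
  have B: "1 \<le> (\<alpha> * R ^ (m - 1))\<^sup>2"
  proof (rule one_le_power)
    show "1 \<le> \<alpha> * R ^ (m - 1)" using mult_mono[OF \<alpha> one_le_power[OF R]] \<alpha> by simp
  qed
  have "24 * real m * \<kappa> * R \<le> 24 * real m * \<kappa> * R * (\<alpha> * R ^ (m - 1))\<^sup>2"
    using mult_left_mono[OF B, of "24 * real m * \<kappa> * R"] \<kappa> R by simp
  also have "\<dots> \<le> \<zeta>\<^sup>2 * sqrt s" by (rule 24)
  also have "\<dots> \<le> \<zeta> * sqrt s"
    using \<zeta> \<zeta>_le_1 sqrt_s by (intro mult_right_mono) (auto simp: power2_eq_square mult_left_le)
  finally have le: "24 * real m * \<kappa> * R \<le> \<zeta> * sqrt s" .
  then show 2: "3 * \<eta> \<le> sqrt s"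
  proof -
    have "12 * real m * \<kappa> * R \<le> 24 * real m * \<kappa> * R" using \<kappa> R by (intro mult_right_mono) auto
    with le have "12 * real m * \<kappa> * R \<le> \<zeta> * sqrt s" by linarith
    then show ?thesis using \<zeta> by (simp add: \<eta>_def field_simps)
  qed
  show "\<eta> \<le> 1" using 0 2 sqrt_s(2) by linarith
  have "24 * real m * \<kappa> \<le> 24 * real m * \<kappa> * R"
    using mult_left_mono[OF R, of "24 * real m * \<kappa>"] \<kappa> by simp
  also have "\<dots> \<le> \<zeta>" using le sqrt_s \<zeta> mult_left_le[of "sqrt s" \<zeta>] by linarith
  finally have "24 * real m * \<kappa> \<le> \<zeta>" .
  moreover have "0 \<le> real m * \<kappa>" using \<kappa> by simp
  ultimately show "2 * real m * \<kappa> \<le> \<zeta>" by linarith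
  then show "real m * \<kappa> < \<zeta>" using \<zeta> by linarith
qed

section \<open>Dual families and one-coordinate slices\<close>

lemma f_ge_1:
  assumes "k \<in> {1..m}" "j \<in> {1..d}"
  shows "1 \<le> norm (f k j)"
  using norm_cauchy_schwarz[of "f k j" e] f_e[OF assms] by (simp add: norm_e)

lemma f_separated:
  assumes "k \<in> {1..m}" "k' \<in> {1..m}" "k \<noteq> k'" "j \<in> {1..d}"
  shows "sqrt s \<le> norm (f k j - f k' j)"
  unfolding s_def using assms by (intro incoherent_separation f_ge_1 \<mu> f_incoherent)

lemma duals:
  assumes "S \<subseteq> {1..d}" "card S = m - 1"
  obtains a where
    "\<And>k j. k \<in> {1..m} \<Longrightarrow> j \<in> S \<Longrightarrow> norm (a k j) \<le> 1 / sqrt s"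
    "\<And>k k'. k \<in> {1..m} \<Longrightarrow> k' \<in> {1..m} \<Longrightarrow> (\<Prod>j\<in>S. inner (a k j) (f k' j)) = of_bool (k = k')"
proof -
  note goal = that
  have fin: "finite S" using assms by (auto intro: finite_subset)
  show ?thesis
  proof (rule dual_products[where f = f and S = S and m = m and \<mu> = \<mu>])
    show "1 \<le> norm (f k j)" if "k \<in> {1..m}" "j \<in> S" for k j
      using f_ge_1 that assms(1) by blast
    show "\<bar>inner (f k j) (f k' j)\<bar> \<le> \<mu> * norm (f k j) * norm (f k' j)"
      if "k \<in> {1..m}" "k' \<in> {1..m}" "k \<noteq> k'" "j \<in> S" for k k' j
      using f_incoherent that assms(1) by blast
    show thesis
      if "\<And>k j. k \<in> {1..m} \<Longrightarrow> j \<in> S \<Longrightarrow> norm (a k j) \<le> 1 / sqrt (1 - \<mu>)"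
        "\<And>k k'. k \<in> {1..m} \<Longrightarrow> k' \<in> {1..m} \<Longrightarrow> (\<Prod>j\<in>S. inner (a k j) (f k' j)) = of_bool (k = k')" for a
      by (rule goal[of a]) (use that in \<open>simp_all add: s_def\<close>)
  qed (use fin assms(2) \<mu> in auto)
qed

lemma dual_coeff_le:
  assumes S: "S \<subseteq> {1..d}" "card S = m - 1"
    and a: "\<And>j. j \<in> S \<Longrightarrow> norm (a j) \<le> 1 / sqrt s" and l: "l \<in> {1..m}"
  shows "\<bar>\<Prod>j\<in>S. inner (a j) (g l j)\<bar> \<le> \<alpha> * R ^ (m - 1)"
proof -
  have "\<bar>\<Prod>j\<in>S. inner (a j) (g l j)\<bar> \<le> (\<Prod>j\<in>S. 1 / sqrt s * R)"
    unfolding abs_prod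
  proof (intro prod_mono conjI)
    fix j assume j: "j \<in> S"
    have "\<bar>inner (a j) (g l j)\<bar> \<le> norm (a j) * norm (g l j)" by (rule Cauchy_Schwarz_ineq2)
    also have "\<dots> \<le> 1 / sqrt s * R"
      using a[OF j] g_R[OF l] j S sqrt_s by (intro mult_mono) auto
    finally show "\<bar>inner (a j) (g l j)\<bar> \<le> 1 / sqrt s * R" .
  qed auto
  also have "\<dots> = \<alpha> * R ^ (m - 1)" using S by (simp only: \<alpha>_def power_mult_distrib prod_constant)
  finally show ?thesis .
qed

text \<open>The weight left to component \<open>l\<close> of the estimate once all coordinates
  outside \<open>S\<close>, \<open>T\<close> and \<open>i\<close> have been paired with
  \<open>e\<close>.\<close>

definition residual_weight :: "nat set \<Rightarrow> nat set \<Rightarrow> nat \<Rightarrow> nat \<Rightarrow> real" where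
  "residual_weight S T i l = w' l * (\<Prod>j\<in>{1..d} - S - T - {i}. inner (g l j) e)"

lemma residual_weight:
  assumes "l \<in> {1..m}"
  shows "0 \<le> residual_weight S T i l" "residual_weight S T i l \<le> w' l"
proof -
  show "0 \<le> residual_weight S T i l"
    unfolding residual_weight_def using assms by (intro mult_nonneg_nonneg prod_nonneg w' g_e) auto
  have "(\<Prod>j\<in>{1..d} - S - T - {i}. inner (g l j) e) \<le> 1"
    using assms by (intro prod_le_1 conjI g_e) auto
  then show "residual_weight S T i l \<le> w' l"
    unfolding residual_weight_def using w'(1)[OF assms] by (rule mult_left_le)
qed

text \<open>The test function consists of the duals of \<open>k\<close> on \<open>S\<close> and of
  \<open>k'\<close> on \<open>T\<close>, a free vector \<open>y\<close> at \<open>i\<close>, and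
  \<open>e\<close> elsewhere. Biorthogonality selects a single component of the true mixture, and
  since \<open>y\<close> is arbitrary the scalar estimate becomes one in norm. Each family of duals
  costs a factor \<open>\<alpha>\<close>.\<close>

lemma slice:
  assumes S: "S \<subseteq> {1..d}" "card S = m - 1" and T: "T \<subseteq> {1..d}" "card T = m - 1"
    and i: "i \<in> {1..d}" "i \<notin> S" "i \<notin> T" and ST: "S \<inter> T = {}"
    and a: "\<And>k j. k \<in> {1..m} \<Longrightarrow> j \<in> S \<Longrightarrow> norm (a k j) \<le> 1 / sqrt s"
      "\<And>k k'. k \<in> {1..m} \<Longrightarrow> k' \<in> {1..m} \<Longrightarrow> (\<Prod>j\<in>S. inner (a k j) (f k' j)) = of_bool (k = k')"
    and b: "\<And>k j. k \<in> {1..m} \<Longrightarrow> j \<in> T \<Longrightarrow> norm (b k j) \<le> 1 / sqrt s"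
      "\<And>k k'. k \<in> {1..m} \<Longrightarrow> k' \<in> {1..m} \<Longrightarrow> (\<Prod>j\<in>T. inner (b k j) (f k' j)) = of_bool (k = k')"
    and k: "k \<in> {1..m}" "k' \<in> {1..m}"
  shows "norm ((of_bool (k = k') * w k) *\<^sub>R f k i
      - (\<Sum>l\<in>{1..m}. (residual_weight S T i l * (\<Prod>j\<in>S. inner (a k j) (g l j)) * (\<Prod>j\<in>T. inner (b k' j) (g l j)))
          *\<^sub>R g l i)) \<le> \<kappa>" (is "norm ?E \<le> \<kappa>")
proof (rule norm_le_of_inner_le)
  fix y :: 'a
  define h where "h j = (if j \<in> S then a k j else if j \<in> T then b k' j else if j = i then y else e)" for j
  \<comment> \<open>\<open>p\<close> is kept general because the split is applied to inner products
    with \<open>f\<close>, to inner products with \<open>g\<close> and to norms.\<close>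
  have split: "(\<Prod>j\<in>{1..d}. p j (h j))
      = (\<Prod>j\<in>S. p j (a k j)) * (\<Prod>j\<in>T. p j (b k' j)) * p i y * (\<Prod>j\<in>{1..d} - S - T - {i}. p j e)"
    for p :: "nat \<Rightarrow> 'a \<Rightarrow> real"
  proof -
    have "(\<Prod>j\<in>{1..d}. p j (h j)) = (\<Prod>j\<in>S. p j (h j)) * (\<Prod>j\<in>T. p j (h j)) * p i (h i)
        * (\<Prod>j\<in>{1..d} - S - T - {i}. p j (h j))"
      using S T i ST by (intro prod_split3) auto
    moreover have "(\<Prod>j\<in>S. p j (h j)) = (\<Prod>j\<in>S. p j (a k j))"
      by (rule prod.cong) (auto simp: h_def)
    moreover have "(\<Prod>j\<in>T. p j (h j)) = (\<Prod>j\<in>T. p j (b k' j))"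
      using ST by (intro prod.cong) (auto simp: h_def)
    moreover have "(\<Prod>j\<in>{1..d} - S - T - {i}. p j (h j)) = (\<Prod>j\<in>{1..d} - S - T - {i}. p j e)"
      by (intro prod.cong) (auto simp: h_def)
    ultimately show ?thesis using i by (simp add: h_def)
  qed
  have "(\<Sum>k''\<in>{1..m}. w k'' * (\<Prod>j\<in>{1..d}. inner (f k'' j) (h j)))
      = (\<Sum>k''\<in>{1..m}. if k'' = k then of_bool (k = k') * w k * inner (f k i) y else 0)"
  proof (rule sum.cong)
    fix k'' assume k'': "k'' \<in> {1..m}"
    have "(\<Prod>j\<in>{1..d} - S - T - {i}. inner (f k'' j) e) = 1"
      using k'' by (intro prod.neutral) (auto simp: f_e)
    then have "(\<Prod>j\<in>{1..d}. inner (f k'' j) (h j)) = of_bool (k = k'') * of_bool (k' = k'') * inner (f k'' i) y"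
      using a(2)[OF k(1) k''] b(2)[OF k(2) k''] unfolding split[of "\<lambda>j. inner (f k'' j)"] by (simp add: inner_commute[of "f k'' _"])
    then show "w k'' * (\<Prod>j\<in>{1..d}. inner (f k'' j) (h j))
        = (if k'' = k then of_bool (k = k') * w k * inner (f k i) y else 0)"
      by auto
  qed simp
  then have 1: "(\<Sum>k''\<in>{1..m}. w k'' * (\<Prod>j\<in>{1..d}. inner (f k'' j) (h j))) = of_bool (k = k') * w k * inner (f k i) y"
    using k by simp
  have 2: "(\<Sum>l\<in>{1..m}. w' l * (\<Prod>j\<in>{1..d}. inner (g l j) (h j)))
      = inner (\<Sum>l\<in>{1..m}. (residual_weight S T i l * (\<Prod>j\<in>S. inner (a k j) (g l j))
          * (\<Prod>j\<in>T. inner (b k' j) (g l j))) *\<^sub>R g l i) y"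
    unfolding inner_sum_left
  proof (rule sum.cong)
    fix l
    show "w' l * (\<Prod>j\<in>{1..d}. inner (g l j) (h j)) = inner ((residual_weight S T i l * (\<Prod>j\<in>S. inner (a k j) (g l j))
          * (\<Prod>j\<in>T. inner (b k' j) (g l j))) *\<^sub>R g l i) y"
      unfolding split[of "\<lambda>j. inner (g l j)"] residual_weight_def inner_scaleR_left
        inner_commute[of "a k _"] inner_commute[of "b k' _"]
      by (simp only: mult_ac)
  qed simp
  have "inner ?E y = of_bool (k = k') * w k * inner (f k i) y - (\<Sum>l\<in>{1..m}. w' l * (\<Prod>j\<in>{1..d}. inner (g l j) (h j)))"
    unfolding 2 by (simp add: inner_diff_left)
  also have "\<dots> \<le> \<epsilon> * (\<Prod>j\<in>{1..d}. norm (h j))"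
    using close[of h] unfolding 1 by linarith
  also have "\<dots> = \<epsilon> * ((\<Prod>j\<in>S. norm (a k j)) * (\<Prod>j\<in>T. norm (b k' j)) * norm y)"
    unfolding split[of "\<lambda>_. norm"] by (simp add: norm_e)
  also have "\<dots> \<le> \<epsilon> * (\<alpha> * \<alpha> * norm y)"
  proof -
    have "(\<Prod>j\<in>S. norm (a k j)) \<le> (\<Prod>j\<in>S. 1 / sqrt s)"
      using a(1) k by (intro prod_mono) auto
    moreover have "(\<Prod>j\<in>T. norm (b k' j)) \<le> (\<Prod>j\<in>T. 1 / sqrt s)"
      using b(1) k by (intro prod_mono) auto
    ultimately show ?thesis
      using S T \<epsilon> \<alpha> by (intro mult_left_mono mult_right_mono mult_mono) (auto simp: \<alpha>_def intro!: prod_nonneg)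
  qed
  finally show "inner ?E y \<le> \<kappa> * norm y" by (simp add: \<kappa>_def power2_eq_square mult_ac)
qed (rule \<kappa>)

section \<open>Matching of the components\<close>

lemma other_block:
  assumes T: "T \<subseteq> {1..d}" "card T = m - 1" and i: "i \<in> {1..d}" "i \<notin> T"
  obtains S where "S \<subseteq> {1..d}" "card S = m - 1" "i \<notin> S" "S \<inter> T = {}"
proof -
  \<comment> \<open>Beyond \<open>T\<close> and \<open>i\<close> there remain \<open>d - m\<close>
    coordinates, at least \<open>m - 1\<close> because \<open>2 * m - 1 \<le> d\<close>.\<close>
  have "card ({1..d} - insert i T) = d - m"
    using T i m finite_subset[OF T(1)] by (subst card_Diff_subset) auto
  then have "m - 1 \<le> card ({1..d} - insert i T)" using d by simp
  then obtain S where "S \<subseteq> {1..d} - insert i T" "card S = m - 1"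
    using obtain_subset_with_card_n by metis
  then show ?thesis using that by blast
qed

text \<open>\<open>Q\<close> is built from \<open>T\<close> alone. Its inverse \<open>U\<close>, and
  with it \<open>\<tau>\<close>, therefore serves all coordinates \<open>i\<close> outside
  \<open>T\<close>, although \<open>S\<close>, \<open>v\<close> and \<open>P\<close> vary with
  \<open>i\<close>. The value \<open>\<tau> l\<close> is the row in which column \<open>l\<close> of
  \<open>U\<close> has its largest entry.\<close>

lemma matching:
  assumes T: "T \<subseteq> {1..d}" "card T = m - 1"
  obtains \<tau> where "\<tau> ` {1..m} = {1..m}"
    "\<And>l i. l \<in> {1..m} \<Longrightarrow> i \<in> {1..d} \<Longrightarrow> i \<notin> T \<Longrightarrow>
      0 < inner (g l i) e \<and> norm (f (\<tau> l) i - g l i /\<^sub>R inner (g l i) e) \<le> \<eta>"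
proof -
  let ?B = "\<alpha> * R ^ (m - 1)"
  obtain b where b: "\<And>k j. k \<in> {1..m} \<Longrightarrow> j \<in> T \<Longrightarrow> norm (b k j) \<le> 1 / sqrt s"
    "\<And>k k'. k \<in> {1..m} \<Longrightarrow> k' \<in> {1..m} \<Longrightarrow> (\<Prod>j\<in>T. inner (b k j) (f k' j)) = of_bool (k = k')"
    by (rule duals[OF T], rule that)
  define Q where "Q k l = (\<Prod>j\<in>T. inner (b k j) (g l j))" for k l
  have Q: "\<bar>Q k l\<bar> \<le> ?B" if "k \<in> {1..m}" "l \<in> {1..m}" for k l
    unfolding Q_def by (rule dual_coeff_le[OF T b(1)[OF that(1)] that(2)])
  have slices: thesis
    if i: "i \<in> {1..d}" "i \<notin> T"
      and goal: "\<And>v P. (\<And>l. l \<in> {1..m} \<Longrightarrow> 0 \<le> v l) \<Longrightarrow> (\<And>l. l \<in> {1..m} \<Longrightarrow> v l \<le> w' l) \<Longrightarrow>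
        (\<And>k l. k \<in> {1..m} \<Longrightarrow> l \<in> {1..m} \<Longrightarrow> \<bar>P k l\<bar> \<le> ?B) \<Longrightarrow>
        (\<And>k k'. k \<in> {1..m} \<Longrightarrow> k' \<in> {1..m} \<Longrightarrow> norm ((of_bool (k = k') * w k) *\<^sub>R f k i
          - (\<Sum>l\<in>{1..m}. (v l * P k l * Q k' l) *\<^sub>R g l i)) \<le> \<kappa>) \<Longrightarrow> thesis"
    for i thesis
  proof -
    obtain S where S: "S \<subseteq> {1..d}" "card S = m - 1" "i \<notin> S" "S \<inter> T = {}"
      using other_block[OF T i] .
    obtain a where a: "\<And>k j. k \<in> {1..m} \<Longrightarrow> j \<in> S \<Longrightarrow> norm (a k j) \<le> 1 / sqrt s"
      "\<And>k k'. k \<in> {1..m} \<Longrightarrow> k' \<in> {1..m} \<Longrightarrow> (\<Prod>j\<in>S. inner (a k j) (f k' j)) = of_bool (k = k')"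
      by (rule duals[OF S(1,2)], rule that)
    show ?thesis
    proof (rule goal[of "residual_weight S T i" "\<lambda>k l. \<Prod>j\<in>S. inner (a k j) (g l j)"])
      show "\<bar>\<Prod>j\<in>S. inner (a k j) (g l j)\<bar> \<le> ?B" if "k \<in> {1..m}" "l \<in> {1..m}" for k l
        by (rule dual_coeff_le[OF S(1,2) a(1)[OF that(1)] that(2)])
      show "norm ((of_bool (k = k') * w k) *\<^sub>R f k i
          - (\<Sum>l\<in>{1..m}. (residual_weight S T i l * (\<Prod>j\<in>S. inner (a k j) (g l j)) * Q k' l) *\<^sub>R g l i)) \<le> \<kappa>"
        if "k \<in> {1..m}" "k' \<in> {1..m}" for k k'
        unfolding Q_def by (rule slice[where a = a and b = b]) (fact S T i a b that)+
    qed (rule residual_weight(1), assumption, rule residual_weight(2), assumption)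
  qed
  \<comment> \<open>A single coordinate \<open>i0\<close> outside \<open>T\<close> is used to invert
    \<open>Q\<close> and to show that \<open>\<tau>\<close> is onto.\<close>
  have "card T < card {1..d}" using T d m by simp
  then have "{1..d} \<noteq> T" by blast
  then obtain i0 where i0: "i0 \<in> {1..d}" "i0 \<notin> T" using T(1) by blast
  obtain v P where v: "\<And>l. l \<in> {1..m} \<Longrightarrow> 0 \<le> v l" "\<And>l. l \<in> {1..m} \<Longrightarrow> v l \<le> w' l"
    and P: "\<And>k l. k \<in> {1..m} \<Longrightarrow> l \<in> {1..m} \<Longrightarrow> \<bar>P k l\<bar> \<le> ?B"
    and E: "\<And>k k'. k \<in> {1..m} \<Longrightarrow> k' \<in> {1..m} \<Longrightarrow> norm ((of_bool (k = k') * w k) *\<^sub>R f k i0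
        - (\<Sum>l\<in>{1..m}. (v l * P k l * Q k' l) *\<^sub>R g l i0)) \<le> \<kappa>"
    by (rule slices[OF i0], rule that)
  have kernel: "\<forall>k\<in>{1..m}. u k = 0" if "\<And>l. l \<in> {1..m} \<Longrightarrow> (\<Sum>k\<in>{1..m}. Q k l * u k) = 0" for u
    using contracted_kernel[where x = "\<lambda>k. f k i0" and u = u, OF E f_ge_1[OF _ i0(1)] w(1) \<zeta> \<eta>(5) that] .
  obtain U where U: "\<And>l l'. l \<in> {1..m} \<Longrightarrow> l' \<in> {1..m} \<Longrightarrow> (\<Sum>k\<in>{1..m}. Q k l * U k l') = of_bool (l = l')"
    "\<And>k k'. k \<in> {1..m} \<Longrightarrow> k' \<in> {1..m} \<Longrightarrow> (\<Sum>l\<in>{1..m}. U k l * Q k' l) = of_bool (k = k')"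
    by (rule square_matrix_inverse[of m Q, OF kernel], assumption, rule that)
  have "\<exists>t. t \<in> {1..m} \<and> (\<forall>k\<in>{1..m}. \<bar>U k l\<bar> \<le> \<bar>U t l\<bar>)" for l
    using finite_argmax[of m "\<lambda>k. \<bar>U k l\<bar>"] m by (metis one_le_numeral order_trans)
  then obtain \<tau> where \<tau>: "\<And>l. \<tau> l \<in> {1..m}" "\<And>l k. k \<in> {1..m} \<Longrightarrow> \<bar>U k l\<bar> \<le> \<bar>U (\<tau> l) l\<bar>"
    by metis
  show ?thesis
  proof (rule that[of \<tau>])
    fix l i assume l: "l \<in> {1..m}" and i: "i \<in> {1..d}" "i \<notin> T"
    obtain v P where E: "\<And>k k'. k \<in> {1..m} \<Longrightarrow> k' \<in> {1..m} \<Longrightarrow> norm ((of_bool (k = k') * w k) *\<^sub>R f k i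
        - (\<Sum>l\<in>{1..m}. (v l * P k l * Q k' l) *\<^sub>R g l i)) \<le> \<kappa>"
      by (rule slices[OF i], rule that)
    \<comment> \<open>Column \<open>l\<close> of \<open>U\<close> is the vector dual to column
      \<open>l\<close> of \<open>Q\<close>.\<close>
    note est = contracted_estimate[where x = "\<lambda>k. f k i" and y = "\<lambda>l. g l i" and u = "\<lambda>k. U k l",
        OF E eq_refl[OF norm_e] f_e[OF _ i(1)] f_R[OF _ i(1)] R w(1) \<zeta> \<kappa>(1) \<eta>(4) l g_e(1)[OF l i(1)] U(1)[OF _ l] \<tau>]
    then show "0 < inner (g l i) e \<and> norm (f (\<tau> l) i - g l i /\<^sub>R inner (g l i) e) \<le> \<eta>"
      unfolding \<eta>_def by blast
  next
    \<comment> \<open>The products \<open>U k l * Q k l\<close> sum to 1 over \<open>l\<close>,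
      because \<open>U\<close> is a two-sided inverse. If \<open>k\<close> were missed, each would
      be at most \<open>w' l / 2\<close> in absolute value, and their sum at most one half.\<close>
    have "k \<in> \<tau> ` {1..m}" if k: "k \<in> {1..m}" for k
    proof (rule ccontr)
      assume "k \<notin> \<tau> ` {1..m}"
      then have k\<tau>: "k \<noteq> \<tau> l" if "l \<in> {1..m}" for l using that by blast
      have "\<bar>U k l * Q k l\<bar> \<le> w' l / 2" if l: "l \<in> {1..m}" for l
      proof -
        note est = contracted_estimate[where x = "\<lambda>k. f k i0" and y = "\<lambda>l. g l i0" and u = "\<lambda>k. U k l",
          OF E eq_refl[OF norm_e] f_e[OF _ i0(1)] f_R[OF _ i0(1)] R w(1) \<zeta> \<kappa>(1) \<eta>(4) l g_e(1)[OF l i0(1)] U(1)[OF _ l] \<tau>]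
        let ?z = "g l i0 /\<^sub>R inner (g l i0) e" and ?u = "\<bar>U (\<tau> l) l\<bar>"
        have near: "norm (f (\<tau> l) i0 - ?z) \<le> \<eta>" using est(2) by (simp add: \<eta>_def)
        have "norm ?z \<le> norm (f (\<tau> l) i0) + norm (f (\<tau> l) i0 - ?z)"
          by (metis norm_minus_commute norm_triangle_sub)
        then have z: "1 + norm ?z \<le> 3 * R"
          using near \<eta>(2) R f_R[OF \<tau>(1) i0(1)] by (smt (verit))
        \<comment> \<open>\<open>?z\<close> is within \<open>\<eta> \<le> sqrt s / 3\<close> of
          component \<open>\<tau> l\<close>, which is at least \<open>sqrt s\<close> away from
          component \<open>k\<close>.\<close>
        have "norm (f k i0 - f (\<tau> l) i0) \<le> norm (f k i0 - ?z) + norm (f (\<tau> l) i0 - ?z)"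
          by (metis dist_norm dist_triangle2)
        then have far: "sqrt s / 2 \<le> norm (f k i0 - ?z)"
          using near \<eta>(1,3) f_separated[OF k \<tau>(1) k\<tau>[OF l] i0(1)] by linarith
        have "\<zeta> * \<bar>U k l\<bar> * (sqrt s / 2) \<le> \<zeta> * \<bar>U k l\<bar> * norm (f k i0 - ?z)"
          using far \<zeta> by (intro mult_left_mono) auto
        also have "\<dots> \<le> real m * \<kappa> * ?u * (1 + norm ?z)" by (rule est(3)) (use k in auto)
        also have "\<dots> \<le> real m * \<kappa> * ?u * (3 * R)"
          using z \<kappa> by (intro mult_left_mono) auto
        finally have "\<zeta> * \<bar>U k l\<bar> * sqrt s \<le> 6 * real m * \<kappa> * R * ?u" by (simp add: mult_ac)
        \<comment> \<open>The extra factor \<open>\<zeta>\<close> creates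
          \<open>\<zeta> * ?u\<close>, which the fourth estimate bounds by a multiple of
          \<open>w' l\<close>. A bound proportional to \<open>w' l\<close> stays under control when
          summed over \<open>l\<close>.\<close>
        then have 1: "\<zeta> * (\<zeta> * \<bar>U k l\<bar> * sqrt s) \<le> \<zeta> * (6 * real m * \<kappa> * R * ?u)"
          using \<zeta> by (intro mult_left_mono) auto
        have "\<zeta> * ?u \<le> 2 * \<bar>v l * inner (g l i0) e * P (\<tau> l) l\<bar>" by (rule est(4))
        also have "\<bar>v l * inner (g l i0) e * P (\<tau> l) l\<bar> \<le> w' l * 1 * ?B"
          unfolding abs_mult using v(1,2)[OF l] g_e[OF l i0(1)] P[OF \<tau>(1) l]
          by (intro mult_mono) auto
        finally have "6 * real m * \<kappa> * R * (\<zeta> * ?u) \<le> 6 * real m * \<kappa> * R * (2 * (w' l * ?B))"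
          using \<kappa> R by (intro mult_left_mono) auto
        with 1 have "\<zeta>\<^sup>2 * sqrt s * \<bar>U k l\<bar> \<le> 12 * real m * \<kappa> * R * ?B * w' l"
          by (simp add: power2_eq_square mult_ac)
        then have "\<zeta>\<^sup>2 * sqrt s * \<bar>U k l\<bar> * \<bar>Q k l\<bar> \<le> 12 * real m * \<kappa> * R * ?B * w' l * ?B"
          using Q[OF k l]
          by (rule mult_mono) (use \<kappa> R \<alpha> w'(1)[OF l] in \<open>auto intro!: mult_nonneg_nonneg\<close>)
        also have "\<dots> = (24 * real m * \<kappa> * R * ?B\<^sup>2) * (w' l / 2)"
          by (simp add: power2_eq_square)
        also have "\<dots> \<le> \<zeta>\<^sup>2 * sqrt s * (w' l / 2)"
          using \<eta>(6) w'(1)[OF l] by (intro mult_right_mono) auto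
        finally have "\<zeta>\<^sup>2 * sqrt s * \<bar>U k l * Q k l\<bar> \<le> \<zeta>\<^sup>2 * sqrt s * (w' l / 2)"
          by (simp add: abs_mult mult_ac)
        then show ?thesis using \<zeta> sqrt_s by (subst (asm) mult_le_cancel_left_pos) auto
      qed
      then have "(\<Sum>l\<in>{1..m}. U k l * Q k l) \<le> (\<Sum>l\<in>{1..m}. w' l / 2)"
        by (intro sum_mono) (meson abs_le_D1)
      then show False using U(2)[OF k k] w'(2) by (simp flip: sum_divide_distrib)
    qed
    then show "\<tau> ` {1..m} = {1..m}" using \<tau>(1) by blast
  qed
qed

text \<open>The matching of a block only concerns coordinates outside it, so two disjoint blocks
  together cover all coordinates. Both matchings apply at coordinate \<open>2 * m - 1\<close>, where
  incoherence allows at most one component within \<open>\<eta>\<close> of a given vector; hence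
  they agree.\<close>

lemma global_matching:
  obtains \<tau> where "bij_betw \<tau> {1..m} {1..m}"
    "\<And>l i. l \<in> {1..m} \<Longrightarrow> i \<in> {1..d} \<Longrightarrow>
      0 < inner (g l i) e \<and> norm (f (\<tau> l) i - g l i /\<^sub>R inner (g l i) e) \<le> \<eta>"
proof -
  have T: "{1..m-1} \<subseteq> {1..d}" "card {1..m-1} = m - 1" "{m..2*m-2} \<subseteq> {1..d}" "card {m..2*m-2} = m - 1"
    using d m by auto
  obtain \<tau> where \<tau>: "\<tau> ` {1..m} = {1..m}" "\<And>l i. l \<in> {1..m} \<Longrightarrow> i \<in> {1..d} \<Longrightarrow> i \<notin> {1..m-1} \<Longrightarrow>
      0 < inner (g l i) e \<and> norm (f (\<tau> l) i - g l i /\<^sub>R inner (g l i) e) \<le> \<eta>"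
    using matching[OF T(1,2)] by metis
  obtain \<tau>' where \<tau>': "\<tau>' ` {1..m} = {1..m}" "\<And>l i. l \<in> {1..m} \<Longrightarrow> i \<in> {1..d} \<Longrightarrow> i \<notin> {m..2*m-2} \<Longrightarrow>
      0 < inner (g l i) e \<and> norm (f (\<tau>' l) i - g l i /\<^sub>R inner (g l i) e) \<le> \<eta>"
    using matching[OF T(3,4)] by metis
  have i: "2*m-1 \<in> {1..d}" "2*m-1 \<notin> {1..m-1}" "2*m-1 \<notin> {m..2*m-2}" using d m by auto
  have eq: "\<tau> l = \<tau>' l" if l: "l \<in> {1..m}" for l
  proof (rule ccontr)
    assume "\<tau> l \<noteq> \<tau>' l"
    moreover have "\<tau> l \<in> {1..m}" "\<tau>' l \<in> {1..m}" using \<tau>(1) \<tau>'(1) l by blast+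
    ultimately have "sqrt s \<le> norm (f (\<tau> l) (2*m-1) - f (\<tau>' l) (2*m-1))"
      using f_separated i(1) by blast
    also have "\<dots> \<le> norm (f (\<tau> l) (2*m-1) - g l (2*m-1) /\<^sub>R inner (g l (2*m-1)) e)
        + norm (f (\<tau>' l) (2*m-1) - g l (2*m-1) /\<^sub>R inner (g l (2*m-1)) e)"
      by (metis dist_norm dist_triangle2)
    finally have "sqrt s \<le> 2 * \<eta>" using \<tau>(2)[OF l i(1,2)] \<tau>'(2)[OF l i(1,3)] by linarith
    then show False using \<eta>(1,3) sqrt_s(1) by linarith
  qed
  show ?thesis
  proof (rule that[of \<tau>])
    show "bij_betw \<tau> {1..m} {1..m}"
      using \<tau>(1) by (simp add: bij_betw_def eq_card_imp_inj_on)
    show "0 < inner (g l i) e \<and> norm (f (\<tau> l) i - g l i /\<^sub>R inner (g l i) e) \<le> \<eta>"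
      if "l \<in> {1..m}" "i \<in> {1..d}" for l i
      using \<tau>(2)[OF that] \<tau>'(2)[OF that] eq[OF that(1)] m by (cases "i \<in> {1..m-1}") auto
  qed
qed

section \<open>Comparison of the weights\<close>

lemma dual_coeff_near:
  assumes S: "S \<subseteq> {1..d}" "card S = m - 1"
    and a: "\<And>j. j \<in> S \<Longrightarrow> norm (a j) \<le> 1 / sqrt s"
    and k: "k \<in> {1..m}" and z: "\<And>j. j \<in> S \<Longrightarrow> norm (f k j - z j) \<le> \<eta>"
  shows "\<bar>(\<Prod>j\<in>S. inner (a j) (z j)) - (\<Prod>j\<in>S. inner (a j) (f k j))\<bar> \<le> 8 * X"
proof -
  have "\<bar>(\<Prod>j\<in>S. inner (a j) (z j)) - (\<Prod>j\<in>S. inner (a j) (f k j))\<bar>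
      \<le> (1 / sqrt s * R + 1 / sqrt s * \<eta>) ^ card S - (1 / sqrt s * R) ^ card S"
  proof (rule abs_prod_diff_le)
    fix j assume j: "j \<in> S"
    have "\<bar>inner (a j) (z j) - inner (a j) (f k j)\<bar> = \<bar>inner (a j) (f k j - z j)\<bar>"
      by (simp add: inner_diff_right abs_minus_commute)
    also have "\<dots> \<le> norm (a j) * norm (f k j - z j)" by (rule Cauchy_Schwarz_ineq2)
    also have "\<dots> \<le> 1 / sqrt s * \<eta>" using a[OF j] z[OF j] sqrt_s by (intro mult_mono) auto
    finally show "\<bar>inner (a j) (z j) - inner (a j) (f k j)\<bar> \<le> 1 / sqrt s * \<eta>" .
    have "\<bar>inner (a j) (f k j)\<bar> \<le> norm (a j) * norm (f k j)" by (rule Cauchy_Schwarz_ineq2)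
    also have "\<dots> \<le> 1 / sqrt s * R" using a[OF j] f_R[OF k] j S sqrt_s by (intro mult_mono) auto
    finally show "\<bar>inner (a j) (f k j)\<bar> \<le> 1 / sqrt s * R" .
  qed (use S finite_subset[OF S(1)] \<eta>(1) R s in auto)
  also have "\<dots> = \<alpha> * ((R + \<eta>) ^ (m - 1) - R ^ (m - 1))"
    by (simp only: S(2) \<alpha>_def distrib_left[symmetric] power_mult_distrib right_diff_distrib)
  also have "\<dots> \<le> \<alpha> * (2 * real (m - 1) * \<eta> * R ^ (m - 1))"
  proof (intro mult_left_mono power_add_diff_le R \<eta>(1))
    have "real (m - 1) * \<eta> \<le> real m * \<eta>" using \<eta>(1) by (intro mult_right_mono) auto
    also have "\<dots> \<le> 1" using X \<zeta>_le_1 by linarith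
    finally show "real (m - 1) * \<eta> \<le> 1" .
  qed (use \<alpha> in simp)
  also have "\<dots> \<le> \<alpha> * (2 * real m * \<eta> * R ^ (m - 1))"
    using \<alpha> \<eta>(1) R by (intro mult_left_mono mult_right_mono) auto
  \<comment> \<open>Inserting \<open>\<eta> = 4 * m * \<kappa> * R / \<zeta>\<close> and
    \<open>\<kappa> = \<alpha>\<^sup>2 * \<epsilon>\<close> gives equality, which explains the
    powers in \<open>X\<close>.\<close>
  also have "\<dots> = 8 * X"
  proof -
    have "R ^ m = R * R ^ (m - 1)" using m by (simp flip: power_Suc)
    then show ?thesis by (simp add: X_def \<eta>_def \<kappa>_def power2_eq_square power3_eq_cube mult_ac)
  qed
  finally show ?thesis .
qed

text \<open>When \<open>e\<close> is the indicator of the unit interval, this is the mass that the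
  weighted component \<open>l\<close> of the estimate places in the unit cube.\<close>

definition cube_weight :: "nat \<Rightarrow> real" where
  "cube_weight l = w' l * (\<Prod>j\<in>{1..d}. inner (g l j) e)"

text \<open>Testing with \<open>e\<close> in every coordinate compares the masses in the unit cube.
  That of the true mixture is 1, so the deficits \<open>w' l - cube_weight l\<close> sum to at most
  \<open>\<epsilon>\<close>; as they are nonnegative, each is at most
  \<open>\<epsilon>\<close>.\<close>

lemma cube_weight:
  assumes "l \<in> {1..m}"
  shows "0 \<le> cube_weight l" "cube_weight l \<le> w' l" "w' l - cube_weight l \<le> \<epsilon>"
proof -
  have nonneg: "0 \<le> cube_weight l \<and> cube_weight l \<le> w' l" if l: "l \<in> {1..m}" for l
  proof
    show "0 \<le> cube_weight l"
      unfolding cube_weight_def using l by (intro mult_nonneg_nonneg prod_nonneg w' g_e) auto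
    have "(\<Prod>j\<in>{1..d}. inner (g l j) e) \<le> 1" using l by (intro prod_le_1 conjI g_e) auto
    then show "cube_weight l \<le> w' l"
      unfolding cube_weight_def using w'(1)[OF l] by (rule mult_left_le)
  qed
  then show "0 \<le> cube_weight l" "cube_weight l \<le> w' l" using assms by auto
  have "(\<Sum>k\<in>{1..m}. w k * (\<Prod>j\<in>{1..d}. inner (f k j) e)) = (\<Sum>k\<in>{1..m}. w k)"
    by (intro sum.cong) (simp_all add: f_e del: One_nat_def)
  then have "\<bar>1 - (\<Sum>l\<in>{1..m}. cube_weight l)\<bar> \<le> \<epsilon>"
    using close[of "\<lambda>_. e"] by (simp add: norm_e w(2) cube_weight_def del: One_nat_def)
  moreover have "(\<Sum>l\<in>{1..m}. w' l - cube_weight l) = 1 - (\<Sum>l\<in>{1..m}. cube_weight l)"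
    by (simp only: sum_subtractf w'(2))
  moreover have "w' l - cube_weight l \<le> (\<Sum>l\<in>{1..m}. w' l - cube_weight l)"
    using assms nonneg by (intro member_le_sum) auto
  ultimately show "w' l - cube_weight l \<le> \<epsilon>" by linarith
qed

text \<open>The slice with \<open>k = k' = \<tau> l0\<close> is paired with \<open>e\<close>.
  Writing each \<open>g l j\<close> as its mass times the normalised \<open>z l j\<close> collects
  the masses into \<open>cube_weight l\<close>. The remaining coefficients \<open>p l * q l\<close>
  are close to 1 for \<open>l = l0\<close> and close to 0 otherwise, so up to a small error only the
  cube weight of \<open>l0\<close> survives.\<close>

lemma weight_near:
  assumes \<tau>: "bij_betw \<tau> {1..m} {1..m}"
    and near: "\<And>l i. l \<in> {1..m} \<Longrightarrow> i \<in> {1..d} \<Longrightarrow>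
      0 < inner (g l i) e \<and> norm (f (\<tau> l) i - g l i /\<^sub>R inner (g l i) e) \<le> \<eta>"
    and l0: "l0 \<in> {1..m}"
  shows "\<bar>w (\<tau> l0) - cube_weight l0\<bar> \<le> 25 * X"
proof -
  let ?S = "{1..m-1}" and ?T = "{m..2*m-2}" and ?i = "2*m-1" and ?k = "\<tau> l0"
  have S: "?S \<subseteq> {1..d}" "card ?S = m - 1" and T: "?T \<subseteq> {1..d}" "card ?T = m - 1"
    and i: "?i \<in> {1..d}" "?i \<notin> ?S" "?i \<notin> ?T" and ST: "?S \<inter> ?T = {}"
    using d m by auto
  have k: "?k \<in> {1..m}" using bij_betwE[OF \<tau>] l0 by blast
  obtain a where a: "\<And>k j. k \<in> {1..m} \<Longrightarrow> j \<in> ?S \<Longrightarrow> norm (a k j) \<le> 1 / sqrt s"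
    "\<And>k k'. k \<in> {1..m} \<Longrightarrow> k' \<in> {1..m} \<Longrightarrow> (\<Prod>j\<in>?S. inner (a k j) (f k' j)) = of_bool (k = k')"
    by (rule duals[OF S], rule that)
  obtain b where b: "\<And>k j. k \<in> {1..m} \<Longrightarrow> j \<in> ?T \<Longrightarrow> norm (b k j) \<le> 1 / sqrt s"
    "\<And>k k'. k \<in> {1..m} \<Longrightarrow> k' \<in> {1..m} \<Longrightarrow> (\<Prod>j\<in>?T. inner (b k j) (f k' j)) = of_bool (k = k')"
    by (rule duals[OF T], rule that)
  define z where "z l j = g l j /\<^sub>R inner (g l j) e" for l j
  define p where "p l = (\<Prod>j\<in>?S. inner (a ?k j) (z l j))" for l
  define q where "q l = (\<Prod>j\<in>?T. inner (b ?k j) (z l j))" for l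
  have coeff: "(\<Prod>j\<in>J. inner (c j) (g l j)) = (\<Prod>j\<in>J. inner (g l j) e) * (\<Prod>j\<in>J. inner (c j) (z l j))"
    if "l \<in> {1..m}" "J \<subseteq> {1..d}" for J c l
    unfolding prod.distrib[symmetric]
  proof (rule prod.cong)
    fix j assume "j \<in> J"
    then have "0 < inner (g l j) e" using near that by blast
    then show "inner (c j) (g l j) = inner (g l j) e * inner (c j) (z l j)" by (simp add: z_def)
  qed simp
  let ?E = "(of_bool (?k = ?k) * w ?k) *\<^sub>R f ?k ?i - (\<Sum>l\<in>{1..m}. (residual_weight ?S ?T ?i l
      * (\<Prod>j\<in>?S. inner (a ?k j) (g l j)) * (\<Prod>j\<in>?T. inner (b ?k j) (g l j))) *\<^sub>R g l ?i)"
  have "\<bar>inner ?E e\<bar> \<le> norm ?E * norm e" by (rule Cauchy_Schwarz_ineq2)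
  also have "\<dots> = norm ?E" by (simp only: norm_e mult_1_right)
  also have "\<dots> \<le> \<kappa>"
    by (rule slice[where a = a and b = b]) (fact S T i ST a b k)+
  finally have "\<bar>inner ?E e\<bar> \<le> \<kappa>" .
  moreover have "inner ?E e = w ?k - (\<Sum>l\<in>{1..m}. cube_weight l * (p l * q l))"
  proof -
    have "inner (\<Sum>l\<in>{1..m}. (residual_weight ?S ?T ?i l
        * (\<Prod>j\<in>?S. inner (a ?k j) (g l j)) * (\<Prod>j\<in>?T. inner (b ?k j) (g l j))) *\<^sub>R g l ?i) e
        = (\<Sum>l\<in>{1..m}. cube_weight l * (p l * q l))"
      unfolding inner_sum_left
    proof (rule sum.cong)
      fix l assume l: "l \<in> {1..m}"
      have "(\<Prod>j\<in>{1..d}. inner (g l j) e) = (\<Prod>j\<in>?S. inner (g l j) e) * (\<Prod>j\<in>?T. inner (g l j) e)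
          * inner (g l ?i) e * (\<Prod>j\<in>{1..d} - ?S - ?T - {?i}. inner (g l j) e)"
        by (rule prod_split3) (use S T i ST in auto)
      then show "inner ((residual_weight ?S ?T ?i l
        * (\<Prod>j\<in>?S. inner (a ?k j) (g l j)) * (\<Prod>j\<in>?T. inner (b ?k j) (g l j))) *\<^sub>R g l ?i) e
        = cube_weight l * (p l * q l)"
        unfolding coeff[OF l S(1)] coeff[OF l T(1)] inner_scaleR_left residual_weight_def
          cube_weight_def p_def q_def
        by (simp only: mult_ac)
    qed simp
    then show ?thesis by (simp only: inner_diff_left inner_scaleR_left f_e[OF k i(1)]) simp
  qed
  ultimately have 1: "\<bar>w ?k - (\<Sum>l\<in>{1..m}. cube_weight l * (p l * q l))\<bar> \<le> \<kappa>" by simp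
  have pq: "\<bar>p l * q l - of_bool (l = l0)\<bar> \<le> 24 * X" if l: "l \<in> {1..m}" for l
  proof -
    have \<tau>l: "\<tau> l \<in> {1..m}" using bij_betwE[OF \<tau>] l by blast
    have eq: "of_bool (?k = \<tau> l) = (of_bool (l = l0) :: real)"
      using \<tau> l l0 by (auto simp: bij_betw_def dest: inj_onD)
    have zl: "norm (f (\<tau> l) j - z l j) \<le> \<eta>" if "j \<in> {1..d}" for j
      using near[OF l that] by (simp add: z_def)
    have p: "\<bar>p l - of_bool (l = l0)\<bar> \<le> 8 * X"
      unfolding eq[symmetric] a(2)[OF k \<tau>l, symmetric] p_def
      by (rule dual_coeff_near[OF S a(1)[OF k] \<tau>l zl[OF subsetD[OF S(1)]]])
    have q: "\<bar>q l - of_bool (l = l0)\<bar> \<le> 8 * X"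
      unfolding eq[symmetric] b(2)[OF k \<tau>l, symmetric] q_def
      by (rule dual_coeff_near[OF T b(1)[OF k] \<tau>l zl[OF subsetD[OF T(1)]]])
    have X1: "8 * X \<le> 1" using X(2) \<zeta>_le_1 by linarith
    let ?o = "of_bool (l = l0) :: real"
    \<comment> \<open>Expansion about the common target 0 or 1, with three terms of size at most
      \<open>8 * X\<close>.\<close>
    have "p l * q l - ?o = (p l - ?o) * (q l - ?o) + ?o * (p l - ?o) + ?o * (q l - ?o)"
      by (simp add: algebra_simps)
    also have "\<bar>\<dots>\<bar> \<le> \<bar>p l - ?o\<bar> * \<bar>q l - ?o\<bar> + ?o * \<bar>p l - ?o\<bar> + ?o * \<bar>q l - ?o\<bar>"
    proof -
      have "\<bar>x + ?o * y + ?o * y'\<bar> \<le> \<bar>x\<bar> + ?o * \<bar>y\<bar> + ?o * \<bar>y'\<bar>" for x y y' :: real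
        by (cases "l = l0") auto
      then show ?thesis by (simp only: abs_mult[symmetric])
    qed
    also have "\<dots> \<le> (8 * X) * 1 + 1 * (8 * X) + 1 * (8 * X)"
      using p q X1 X(1) by (intro add_mono mult_mono) auto
    finally show ?thesis by simp
  qed
  have "cube_weight l0 = (\<Sum>l\<in>{1..m}. cube_weight l * of_bool (l = l0))"
    using l0 by (simp add: of_bool_def if_distrib cong: if_cong)
  then have "(\<Sum>l\<in>{1..m}. cube_weight l * (p l * q l)) - cube_weight l0
      = (\<Sum>l\<in>{1..m}. cube_weight l * (p l * q l - of_bool (l = l0)))"
    by (simp only: right_diff_distrib sum_subtractf)
  also have "\<bar>\<dots>\<bar> \<le> (\<Sum>l\<in>{1..m}. w' l * (24 * X))"
  proof (rule order_trans[OF sum_abs], rule sum_mono)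
    fix l assume l: "l \<in> {1..m}"
    show "\<bar>cube_weight l * (p l * q l - of_bool (l = l0))\<bar> \<le> w' l * (24 * X)"
      unfolding abs_mult using cube_weight[OF l] pq[OF l] by (intro mult_mono) auto
  qed
  also have "\<dots> = 24 * X" by (simp only: sum_distrib_right[symmetric] w'(2) mult_1)
  \<comment> \<open>The slice itself contributes \<open>\<kappa> \<le> X\<close> to the total of
    \<open>25 * X\<close>.\<close>
  finally show ?thesis using 1 X(3) by linarith
qed

text \<open>The permutation is the inverse of the matching \<open>\<tau>\<close>. Two corrections
  remain: from \<open>cube_weight\<close> to \<open>w'\<close>, at a cost of at most
  \<open>\<epsilon>\<close>, and from the normalised component back to \<open>g\<close>, whose mass
  \<open>?c\<close> on the unit interval must be shown to be near 1.\<close>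

lemma stability:
  obtains \<sigma> where "\<sigma> permutes {1..m}"
    "\<And>k j. k \<in> {1..m} \<Longrightarrow> j \<in> {1..d} \<Longrightarrow>
      norm (f k j - g (\<sigma> k) j) \<le> (4 * real m + 2) * R * \<epsilon> / ((1 - \<mu>) ^ (m - 1) * \<zeta>)"
    "\<And>k. k \<in> {1..m} \<Longrightarrow> \<bar>w k - w' (\<sigma> k)\<bar>
      \<le> 26 * (real m)\<^sup>2 * (1 / sqrt (1 - \<mu>)) ^ (3 * (m - 1)) * R ^ m * \<epsilon> / \<zeta>"
proof -
  obtain \<tau> where \<tau>: "bij_betw \<tau> {1..m} {1..m}" and near: "\<And>l i. l \<in> {1..m} \<Longrightarrow> i \<in> {1..d} \<Longrightarrow>
      0 < inner (g l i) e \<and> norm (f (\<tau> l) i - g l i /\<^sub>R inner (g l i) e) \<le> \<eta>"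
    by (rule global_matching, rule that)
  define \<sigma> where "\<sigma> k = (if k \<in> {1..m} then the_inv_into {1..m} \<tau> k else k)" for k
  have "bij_betw \<sigma> {1..m} {1..m}"
    using bij_betw_the_inv_into[OF \<tau>] bij_betw_cong[of "{1..m}" \<sigma> "the_inv_into {1..m} \<tau>" "{1..m}"]
    by (simp add: \<sigma>_def)
  then have perm: "\<sigma> permutes {1..m}" by (rule bij_imp_permutes) (auto simp: \<sigma>_def)
  have \<tau>\<sigma>: "\<tau> (\<sigma> k) = k" if "k \<in> {1..m}" for k
    using that \<tau> by (simp add: \<sigma>_def bij_betw_def f_the_inv_into_f)
  have \<sigma>: "\<sigma> k \<in> {1..m}" if "k \<in> {1..m}" for k using permutes_in_image[OF perm] that by blast
  show ?thesis
  proof (rule that[OF perm])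
    fix k assume k: "k \<in> {1..m}"
    have wk: "\<bar>w k - cube_weight (\<sigma> k)\<bar> \<le> 25 * X"
      using weight_near[OF \<tau> near \<sigma>[OF k]] by (simp add: \<tau>\<sigma>[OF k])
    have "\<epsilon> \<le> X" using \<kappa>(2) X(3) by linarith
    then have "\<bar>w k - w' (\<sigma> k)\<bar> \<le> 26 * X"
      using wk cube_weight(2,3)[OF \<sigma>[OF k]] by linarith
    also have "\<dots> = 26 * (real m)\<^sup>2 * (1 / sqrt (1 - \<mu>)) ^ (3 * (m - 1)) * R ^ m * \<epsilon> / \<zeta>"
      by (simp add: X_def \<alpha>_def s_def mult.commute[of 3] power_mult)
    finally show "\<bar>w k - w' (\<sigma> k)\<bar>
      \<le> 26 * (real m)\<^sup>2 * (1 / sqrt (1 - \<mu>)) ^ (3 * (m - 1)) * R ^ m * \<epsilon> / \<zeta>" .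
    fix j assume j: "j \<in> {1..d}"
    let ?l = "\<sigma> k"
    let ?c = "inner (g ?l j) e"
    \<comment> \<open>A matched weight is at least \<open>\<zeta> / 2\<close>, so an absolute loss
      of mass of at most \<open>\<epsilon>\<close> is a relative loss of at most
      \<open>2 * \<epsilon> / \<zeta>\<close>.\<close>
    have "\<zeta> / 2 \<le> w' ?l"
      using wk cube_weight(2)[OF \<sigma>[OF k]] w(1)[OF k] X(2) \<zeta> by linarith
    moreover have "w' ?l * (1 - ?c) \<le> \<epsilon>"
    proof -
      have "(\<Prod>j\<in>{1..d}. inner (g ?l j) e) = ?c * (\<Prod>j\<in>{1..d} - {j}. inner (g ?l j) e)"
        using j by (simp add: prod.remove)
      also have "\<dots> \<le> ?c"
        using g_e[OF \<sigma>[OF k]] j by (intro mult_left_le prod_le_1) auto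
      finally have "w' ?l * (1 - ?c) \<le> w' ?l * (1 - (\<Prod>j\<in>{1..d}. inner (g ?l j) e))"
        using w'(1)[OF \<sigma>[OF k]] by (intro mult_left_mono) auto
      also have "\<dots> \<le> \<epsilon>"
        using cube_weight(3)[OF \<sigma>[OF k]] by (simp add: cube_weight_def right_diff_distrib)
      finally show ?thesis .
    qed
    moreover have c: "0 < ?c" "?c \<le> 1" using near[OF \<sigma>[OF k] j] g_e[OF \<sigma>[OF k] j] by auto
    ultimately have "\<zeta> / 2 * (1 - ?c) \<le> \<epsilon>"
      by (meson diff_ge_0_iff_ge mult_right_mono order_trans)
    then have c1: "1 - ?c \<le> 2 * \<epsilon> / \<zeta>" using \<zeta> by (simp add: field_simps)
    have "f k j - g ?l j = ?c *\<^sub>R (f k j - g ?l j /\<^sub>R ?c) + (1 - ?c) *\<^sub>R f k j"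
      using c by (simp add: algebra_simps)
    then have "norm (f k j - g ?l j) \<le> ?c * norm (f k j - g ?l j /\<^sub>R ?c) + (1 - ?c) * norm (f k j)"
      using norm_triangle_ineq[of "?c *\<^sub>R (f k j - g ?l j /\<^sub>R ?c)" "(1 - ?c) *\<^sub>R f k j"] c by simp
    also have "\<dots> \<le> 1 * \<eta> + 2 * \<epsilon> / \<zeta> * R"
      using near[OF \<sigma>[OF k] j] c c1 f_R[OF k j] \<epsilon> \<zeta> by (intro add_mono mult_mono) (auto simp: \<tau>\<sigma>[OF k])
    \<comment> \<open>Passing from \<open>\<epsilon>\<close> to \<open>\<kappa>\<close> gives both
      terms the denominator \<open>(1 - \<mu>) ^ (m - 1) * \<zeta>\<close>.\<close>
    also have "\<dots> \<le> 1 * \<eta> + 2 * \<kappa> / \<zeta> * R"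
      using \<kappa>(2) \<zeta> R by (intro add_left_mono mult_right_mono divide_right_mono) auto
    also have "\<dots> = (4 * real m + 2) * R * \<epsilon> / ((1 - \<mu>) ^ (m - 1) * \<zeta>)"
      by (simp add: \<eta>_def \<kappa>_def \<alpha>_sq s_def add_divide_distrib[symmetric] algebra_simps)
    finally show "norm (f k j - g ?l j) \<le> (4 * real m + 2) * R * \<epsilon> / ((1 - \<mu>) ^ (m - 1) * \<zeta>)" .
  qed
qed

end

section \<open>Mixtures of product densities\<close>

text \<open>The factorial is at least 1. The constants produced by the stability argument are
  polynomial in \<open>m\<close>, and these bounds compare them with the stated ones.\<close>

lemma L_const_ge:
  assumes "2 \<le> m"
  shows "4 * real m \<le> L_const m" "16 * real m ^ 3 \<le> (L_const m)\<^sup>2"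
proof -
  have 1: "4 * real m powr (3/2) * 1 \<le> L_const m"
    unfolding L_const_def by (intro mult_left_mono fact_ge_1) auto
  have "real m powr 1 \<le> real m powr (3/2)" using assms by (intro powr_mono) auto
  then show "4 * real m \<le> L_const m" using 1 assms by simp
  have "(real m powr (3/2))\<^sup>2 = real m ^ 3"
    using assms by (simp add: power2_eq_square flip: powr_add)
  then have "16 * real m ^ 3 = (4 * real m powr (3/2) * 1)\<^sup>2" by (simp add: power_mult_distrib)
  also have "\<dots> \<le> (L_const m)\<^sup>2" using 1 by (intro power_mono) auto
  finally show "16 * real m ^ 3 \<le> (L_const m)\<^sup>2" .
qed

text \<open>The abstract stability result is applied in \<open>l2\<close>, with \<open>e\<close> the
  indicator of the unit interval and \<open>R = sqrt C\<close>. The assumption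
  \<open>identifiable_dim\<close> provides two blocks of \<open>m - 1\<close> coordinates and one
  more. For small \<open>d\<close> a mixture need not determine its components: at
  \<open>d = 1\<close> the uniform density on the unit interval is the average of the uniform
  densities on its halves, and also of two copies of itself.\<close>

theorem theorem12:
  fixes m d :: nat
    and \<mu> \<zeta> C \<epsilon> :: real
    and w w' :: "nat \<Rightarrow> real"
    and F F' :: "nat \<Rightarrow> nat \<Rightarrow> real \<Rightarrow> real"
  assumes "2 \<le> m" and "1 \<le> d"
    and identifiable_dim: "2 * m - 1 \<le> d"
    and "0 \<le> \<mu>" and "\<mu> < 1" and "0 < \<zeta>"
    and "estimable \<mu> \<zeta> m d w F"
    and "supported_on_unit_cube d (mixture m d w F)"
    and "mixture_params m d w' F'"
    and "1 \<le> C"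
    and "\<And>k j. k \<in> {1..m} \<Longrightarrow> j \<in> {1..d} \<Longrightarrow> linf_norm lborel (F k j) \<le> ereal C"
    and "\<And>k j. k \<in> {1..m} \<Longrightarrow> j \<in> {1..d} \<Longrightarrow> linf_norm lborel (F' k j) \<le> ereal C"
    and "l2_norm (lebesgue_pow d) (\<lambda>x. mixture m d w F x - mixture m d w' F' x) \<le> \<epsilon>"
    and "\<epsilon> < (1 - \<mu>) ^ (2 * m - 1) * \<zeta>\<^sup>2 /
              (32 * real m powr (5/2) * (L_const m)\<^sup>2 * C ^ (2 * m))"
  shows "\<exists>\<sigma>. \<sigma> permutes {1..m} \<and>
    (\<forall>k\<in>{1..m}. \<forall>j\<in>{1..d}.
       l2_norm lborel (\<lambda>x. F k j x - F' (\<sigma> k) j x)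
         \<le> 8 * C\<^sup>2 * L_const m / ((1 - \<mu>) ^ (m - 1) * \<zeta>) * \<epsilon>) \<and>
    sqrt (\<Sum>k\<in>{1..m}. (w k - w' (\<sigma> k))\<^sup>2)
      \<le> 16 * C ^ (2 * m - 2) * (L_const m)\<^sup>2 /
          ((1 - \<mu>) powr (3 * (real m - 1) / 2) * \<zeta>) * \<epsilon>"
proof -
  note m = \<open>2 \<le> m\<close> and \<mu> = \<open>0 \<le> \<mu>\<close> \<open>\<mu> < 1\<close> and \<zeta> = \<open>0 < \<zeta>\<close> and C = \<open>1 \<le> C\<close>
    and L = L_const_ge[OF \<open>2 \<le> m\<close>]
  have par: "mixture_params m d w F" and inc: "\<And>j. j \<in> {1..d} \<Longrightarrow> incoherent lborel \<mu> {1..m} (\<lambda>k. F k j)"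
    and \<zeta>w: "\<zeta> \<le> Min (w ` {1..m})"
    using assms(7) by (auto simp: estimable_def)
  have dens: "is_density (F k j)" "is_density (F' k j)" if "k \<in> {1..m}" "j \<in> {1..d}" for k j
    using par assms(9) that by (auto simp: mixture_params_def)
  have sq: "square_integrable lborel (F k j)" "(l2_norm lborel (F k j))\<^sup>2 \<le> C"
    if "k \<in> {1..m}" "j \<in> {1..d}" for k j
    using bounded_density_square_integrable[OF dens(1)[OF that] assms(11)[OF that]] .
  have sq': "square_integrable lborel (F' k j)" "(l2_norm lborel (F' k j))\<^sup>2 \<le> C"
    if "k \<in> {1..m}" "j \<in> {1..d}" for k j
    using bounded_density_square_integrable[OF dens(2)[OF that] assms(12)[OF that]] .
  have \<epsilon>: "0 \<le> \<epsilon>" using l2_norm_nonneg assms(13) by (rule order_trans)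
  let ?I = "indicator {0..1} :: real \<Rightarrow> real"
  interpret close_product_mixtures m d w w' "\<lambda>k j. abs_l2 (F k j)" "\<lambda>l j. abs_l2 (F' l j)" "abs_l2 ?I"
    \<mu> \<zeta> "sqrt C" \<epsilon>
  proof
    show "2 \<le> m" "2 * m - 1 \<le> d" "0 \<le> \<mu>" "\<mu> < 1" "0 < \<zeta>" "1 \<le> sqrt C" "0 \<le> \<epsilon>"
      using assms \<epsilon> by auto
    show "norm (abs_l2 ?I) = 1"
      by (simp add: norm_abs_l2 square_integrable_indicator l2_norm_indicator)
    show "\<zeta> \<le> w k" if "k \<in> {1..m}" for k
      using \<zeta>w that by (meson Min_le finite_atLeastAtMost finite_imageI imageI order_trans)
    show "(\<Sum>k\<in>{1..m}. w k) = 1" "(\<Sum>l\<in>{1..m}. w' l) = 1"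
      using par assms(9) by (simp_all add: mixture_params_def)
    show "0 \<le> w' l" if "l \<in> {1..m}" for l
      using assms(9) that by (auto simp: mixture_params_def intro: less_imp_le)
    show "inner (abs_l2 (F k j)) (abs_l2 ?I) = 1" if "k \<in> {1..m}" "j \<in> {1..d}" for k j
      using unit_cube_mass[OF par assms(8) that] sq(1)[OF that]
      by (simp add: inner_abs_l2 square_integrable_indicator)
    show "norm (abs_l2 (F k j)) \<le> sqrt C" if "k \<in> {1..m}" "j \<in> {1..d}" for k j
      using sq[OF that] by (simp add: norm_abs_l2 real_le_rsqrt)
    show "norm (abs_l2 (F' k j)) \<le> sqrt C" if "k \<in> {1..m}" "j \<in> {1..d}" for k j
      using sq'[OF that] by (simp add: norm_abs_l2 real_le_rsqrt)
    show "0 \<le> inner (abs_l2 (F' l j)) (abs_l2 ?I)" "inner (abs_l2 (F' l j)) (abs_l2 ?I) \<le> 1"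
      if "l \<in> {1..m}" "j \<in> {1..d}" for l j
      using density_mass_bounds[OF dens(2)[OF that], of "{0..1}"] sq'(1)[OF that]
      by (simp_all add: inner_abs_l2 square_integrable_indicator)
    show "\<bar>inner (abs_l2 (F k j)) (abs_l2 (F k' j))\<bar> \<le> \<mu> * norm (abs_l2 (F k j)) * norm (abs_l2 (F k' j))"
      if "k \<in> {1..m}" "k' \<in> {1..m}" "k \<noteq> k'" "j \<in> {1..d}" for k k' j
      using inc[OF that(4)] that sq(1) by (simp add: incoherent_def inner_abs_l2 norm_abs_l2)
    show "\<bar>(\<Sum>k\<in>{1..m}. w k * (\<Prod>j\<in>{1..d}. inner (abs_l2 (F k j)) (h j)))
        - (\<Sum>l\<in>{1..m}. w' l * (\<Prod>j\<in>{1..d}. inner (abs_l2 (F' l j)) (h j)))\<bar> \<le> \<epsilon> * (\<Prod>j\<in>{1..d}. norm (h j))"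
      for h :: "nat \<Rightarrow> l2"
    proof -
      \<comment> \<open>Test vectors are represented by functions, to which the inequality for
        mixtures applies.\<close>
      have "\<exists>H. square_integrable lborel H \<and> h j = abs_l2 H" for j using l2_cases[of "h j"] by metis
      then obtain H where H: "\<And>j. square_integrable lborel (H j)" and h: "h = (\<lambda>j. abs_l2 (H j))"
        by metis
      have 1: "(\<Sum>k\<in>{1..m}. w k * (\<Prod>j\<in>{1..d}. inner (abs_l2 (F k j)) (h j)))
          = (\<Sum>k\<in>{1..m}. w k * (\<Prod>j\<in>{1..d}. l2_inner lborel (F k j) (H j)))"
        by (intro sum.cong prod.cong refl arg_cong2[where f = times]) (simp add: h inner_abs_l2 sq H)
      have 2: "(\<Sum>k\<in>{1..m}. w' k * (\<Prod>j\<in>{1..d}. inner (abs_l2 (F' k j)) (h j)))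
          = (\<Sum>k\<in>{1..m}. w' k * (\<Prod>j\<in>{1..d}. l2_inner lborel (F' k j) (H j)))"
        by (intro sum.cong prod.cong refl arg_cong2[where f = times]) (simp add: h inner_abs_l2 sq' H)
      have 3: "(\<Prod>j\<in>{1..d}. norm (h j)) = (\<Prod>j\<in>{1..d}. l2_norm lborel (H j))"
        by (simp add: h norm_abs_l2 H)
      have "\<bar>(\<Sum>k\<in>{1..m}. w k * (\<Prod>j\<in>{1..d}. l2_inner lborel (F k j) (H j)))
          - (\<Sum>k\<in>{1..m}. w' k * (\<Prod>j\<in>{1..d}. l2_inner lborel (F' k j) (H j)))\<bar>
        \<le> l2_norm (lebesgue_pow d) (\<lambda>x. mixture m d w F x - mixture m d w' F' x)
          * (\<Prod>j\<in>{1..d}. l2_norm lborel (H j))"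
        by (rule mixture_inner_le) (simp_all only: sq(1) sq'(1) H)
      also have "\<dots> \<le> \<epsilon> * (\<Prod>j\<in>{1..d}. l2_norm lborel (H j))"
        by (intro mult_right_mono assms(13) prod_nonneg ballI l2_norm_nonneg)
      finally show ?thesis unfolding 1 2 3 .
    qed
    show "64 * (real m)\<^sup>2 * sqrt C ^ (2 * m) * \<epsilon> \<le> \<zeta>\<^sup>2 * (1 - \<mu>) ^ (2 * m - 1)"
    proof -
      let ?D = "32 * real m powr (5/2) * (L_const m)\<^sup>2 * C ^ (2 * m)"
      \<comment> \<open>For \<open>R = sqrt C\<close> the power \<open>R ^ (2 * m)\<close> is
        \<open>C ^ m\<close>; the product is then compared with \<open>?D\<close> factor by
        factor.\<close>
      have "64 * (real m)\<^sup>2 * sqrt C ^ (2 * m) = 32 * (real m)\<^sup>2 * 2 * C ^ m"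
        using C by (simp add: power_mult)
      also have "\<dots> \<le> ?D"
      proof (intro mult_mono power_increasing C)
        have "real m powr 2 \<le> real m powr (5/2)" using m by (intro powr_mono) auto
        then show "(real m)\<^sup>2 \<le> real m powr (5/2)" using m by (simp add: powr_realpow)
        have "1 \<le> real m ^ 3" using m by (intro one_le_power) simp
        then show "2 \<le> (L_const m)\<^sup>2" using L(2) by linarith
      qed (use C in auto)
      finally have "64 * (real m)\<^sup>2 * sqrt C ^ (2 * m) * \<epsilon> \<le> ?D * \<epsilon>"
        using \<epsilon> by (rule mult_right_mono)
      also have "0 < ?D" using m C L(1) by (intro mult_pos_pos zero_less_power) auto
      then have "?D * \<epsilon> \<le> (1 - \<mu>) ^ (2 * m - 1) * \<zeta>\<^sup>2"
        using assms(14) by (simp add: field_simps less_imp_le)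
      finally show ?thesis by (simp add: mult.commute)
    qed
  qed
  obtain \<sigma> where \<sigma>: "\<sigma> permutes {1..m}"
    and comp: "\<And>k j. k \<in> {1..m} \<Longrightarrow> j \<in> {1..d} \<Longrightarrow> norm (abs_l2 (F k j) - abs_l2 (F' (\<sigma> k) j))
      \<le> (4 * real m + 2) * sqrt C * \<epsilon> / ((1 - \<mu>) ^ (m - 1) * \<zeta>)"
    and weight: "\<And>k. k \<in> {1..m} \<Longrightarrow> \<bar>w k - w' (\<sigma> k)\<bar>
      \<le> 26 * (real m)\<^sup>2 * (1 / sqrt (1 - \<mu>)) ^ (3 * (m - 1)) * sqrt C ^ m * \<epsilon> / \<zeta>"
    by (rule stability, rule that)
  have sqrtC: "1 \<le> sqrt C" "sqrt C \<le> C"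
    using C by (auto intro!: real_le_lsqrt simp: self_le_power)
  show ?thesis
  proof (intro exI[of _ \<sigma>] conjI ballI \<sigma>)
    fix k j assume kj: "k \<in> {1..m}" "j \<in> {1..d}"
    have \<sigma>k: "\<sigma> k \<in> {1..m}" using permutes_in_image[OF \<sigma>] kj by blast
    have "l2_norm lborel (\<lambda>x. F k j x - F' (\<sigma> k) j x) = norm (abs_l2 (F k j) - abs_l2 (F' (\<sigma> k) j))"
      using sq(1)[OF kj] sq'(1)[OF \<sigma>k kj(2)] by (simp add: abs_l2_diff norm_abs_l2 square_integrable_diff)
    also have "\<dots> \<le> (4 * real m + 2) * sqrt C * \<epsilon> / ((1 - \<mu>) ^ (m - 1) * \<zeta>)"
      by (rule comp[OF kj])
    also have "\<dots> \<le> (8 * L_const m) * C\<^sup>2 * \<epsilon> / ((1 - \<mu>) ^ (m - 1) * \<zeta>)"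
    proof (intro divide_right_mono mult_right_mono mult_mono \<epsilon>)
      show "4 * real m + 2 \<le> 8 * L_const m" using L(1) m by simp
      show "sqrt C \<le> C\<^sup>2" using sqrtC C self_le_power[of C 2] by simp
    qed (use \<mu> \<zeta> C L in auto)
    finally show "l2_norm lborel (\<lambda>x. F k j x - F' (\<sigma> k) j x)
        \<le> 8 * C\<^sup>2 * L_const m / ((1 - \<mu>) ^ (m - 1) * \<zeta>) * \<epsilon>"
      by (simp add: mult_ac)
  next
    let ?A = "(1 / sqrt (1 - \<mu>)) ^ (3 * (m - 1))"
    let ?b = "26 * (real m)\<^sup>2 * ?A * sqrt C ^ m * \<epsilon> / \<zeta>"
    have b: "0 \<le> ?b" using \<mu> C \<epsilon> \<zeta> by simp
    have "(\<Sum>k\<in>{1..m}. (w k - w' (\<sigma> k))\<^sup>2) \<le> (\<Sum>k\<in>{1..m}. ?b\<^sup>2)"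
    proof (rule sum_mono)
      fix k assume "k \<in> {1..m}"
      from power_mono[OF weight[OF this], of 2] show "(w k - w' (\<sigma> k))\<^sup>2 \<le> ?b\<^sup>2" by simp
    qed
    then have "sqrt (\<Sum>k\<in>{1..m}. (w k - w' (\<sigma> k))\<^sup>2) \<le> sqrt (real m * ?b\<^sup>2)"
      by (intro real_sqrt_le_mono) simp
    \<comment> \<open>The factor \<open>sqrt m\<close> comes from summing \<open>m\<close> squares
      with the same bound.\<close>
    also have "\<dots> = sqrt (real m) * ?b" by (simp only: real_sqrt_mult real_sqrt_abs abs_of_nonneg[OF b])
    also have "\<dots> = (26 * (sqrt (real m) * (real m)\<^sup>2)) * sqrt C ^ m * (?A * \<epsilon> / \<zeta>)" by simp
    also have "\<dots> \<le> (16 * (L_const m)\<^sup>2) * C ^ (2 * m - 2) * (?A * \<epsilon> / \<zeta>)"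
    proof (rule mult_right_mono[OF mult_mono])
      \<comment> \<open>It suffices that \<open>26 * m ^ 3\<close> lies below
        \<open>16 * (L_const m)\<^sup>2\<close>, which is at least
        \<open>256 * m ^ 3\<close>.\<close>
      have "sqrt (real m) \<le> real m" using m by (intro real_le_lsqrt) (auto simp: self_le_power)
      then have "sqrt (real m) * (real m)\<^sup>2 \<le> real m * (real m)\<^sup>2" by (intro mult_right_mono) auto
      also have "\<dots> = real m ^ 3" by (simp add: power2_eq_square power3_eq_cube)
      finally show "26 * (sqrt (real m) * (real m)\<^sup>2) \<le> 16 * (L_const m)\<^sup>2" using L(2)
        zero_le_power[of "real m" 3] by linarith
      \<comment> \<open>The comparison of exponents \<open>m \<le> 2 * m - 2\<close> below relies on
        \<open>2 \<le> m\<close>.\<close>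
      have "sqrt C ^ m \<le> C ^ m" using sqrtC by (intro power_mono) auto
      also have "\<dots> \<le> C ^ (2 * m - 2)" using C m by (intro power_increasing) auto
      finally show "sqrt C ^ m \<le> C ^ (2 * m - 2)" .
    qed (use \<mu> \<epsilon> \<zeta> C in auto)
    also have "?A = 1 / (1 - \<mu>) powr (3 * (real m - 1) / 2)"
    proof -
      have "(1 - \<mu>) powr (3 * (real m - 1) / 2) = ((1 - \<mu>) powr (1/2)) powr real (3 * (m - 1))"
        using m by (simp add: powr_powr of_nat_diff)
      also have "\<dots> = sqrt (1 - \<mu>) ^ (3 * (m - 1))"
      proof -
        have "(1 - \<mu>) powr (1/2) = sqrt (1 - \<mu>)" "0 < sqrt (1 - \<mu>)"
          using \<mu> by (simp_all add: powr_half_sqrt)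
        then show ?thesis by (simp only: powr_realpow)
      qed
      finally show ?thesis by (simp add: power_divide)
    qed
    finally show "sqrt (\<Sum>k\<in>{1..m}. (w k - w' (\<sigma> k))\<^sup>2)
      \<le> 16 * C ^ (2 * m - 2) * (L_const m)\<^sup>2 / ((1 - \<mu>) powr (3 * (real m - 1) / 2) * \<zeta>) * \<epsilon>"
      by (simp add: mult_ac)
  qed
qed

end
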